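(* Let $K/\mathbb{Q}$ be a finite Galois extension. Then the image $\mathrm{ld}_{K}(K^{\times})$ is isomorphic (as an abelian group) to the subgroup $\langle \frac{1}{p} : p \text{ prime} \rangle$ of $\mathbb{Q}$.
   Context: For a nonzero prime ideal $\mathfrak{p}$ of $\mathcal{O}_K$ lying over the rational prime $p$, $\nu_{\mathfrak{p}}$ is the discrete valuation of $K$ at $\mathfrak{p}$ normalized to extend $\nu_p$ (so $\nu_{\mathfrak{p}}(p)=1$), and $g(p,K)$ is the number of prime ideals of $\mathcal{O}_K$ over $p$. The arithmetic derivative is $D_K(x) := x \sum_{\mathfrak{p}:\,\nu_{\mathfrak{p}}(x)\neq 0} \frac{\nu_{\mathfrak{p}}(x)}{p\,g(p,K)}$ for $x\neq 0$ (with $p$ the prime below $\mathfrak{p}$), and the arithmetic logarithmic derivative is the group homomorphism $\mathrm{ld}_K: K^{\times} \to \mathbb{Q}$, $\mathrm{ld}_K(x) := D_K(x)/x = \sum_{\mathfrak{p}:\,\nu_{\mathfrak{p}}(x)\neq 0} \frac{\nu_{\mathfrak{p}}(x)}{p\,g(p,K)}$. *)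

theory Defs
  imports
    "HOL-Algebra.QuotRing"
    "HOL-Algebra.Ideal_Product"
    "HOL-Algebra.Elementary_Groups"
    "HOL-Computational_Algebra.Computational_Algebra"
begin

text \<open>
  Number fields are subsets \<open>K\<close> of an ambient field of characteristic 0 (for instance the complex
  numbers, or \<open>K\<close> itself, with \<open>K = UNIV\<close>); the base field is the set \<open>\<rat>\<close> of rationals of the
  ambient type.
\<close>

definition ring_on :: "'a::field set \<Rightarrow> 'a ring" where
  "ring_on S = \<lparr>carrier = S, monoid.mult = (*), one = 1, zero = 0, add = (+)\<rparr>"

definition finite_over_Q :: "'a::field_char_0 set \<Rightarrow> bool" where
  "finite_over_Q K \<longleftrightarrow>
     field (ring_on K) \<and> (\<exists>B. finite B \<and> K = module.span (\<lambda>(q::rat) (x::'a). of_rat q * x) B)"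

definition Aut_over_Q :: "'a::field_char_0 set \<Rightarrow> ('a \<Rightarrow> 'a) set" where
  "Aut_over_Q K = {\<sigma> \<in> ring_iso (ring_on K) (ring_on K). \<forall>x\<in>\<rat>. \<sigma> x = x}"

text \<open>A finite extension is Galois if the fixed field of its automorphism group is the base field.\<close>

definition finite_Galois_over_Q :: "'a::field_char_0 set \<Rightarrow> bool" where
  "finite_Galois_over_Q K \<longleftrightarrow>
     finite_over_Q K \<and> {x \<in> K. \<forall>\<sigma>\<in>Aut_over_Q K. \<sigma> x = x} = \<rat>"

definition ring_of_integers :: "'a::field_char_0 set \<Rightarrow> 'a ring" where
  "ring_of_integers K = ring_on {x \<in> K. algebraic_int x}"

definition nonzero_primes :: "'a::field_char_0 set \<Rightarrow> 'a set set" where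
  "nonzero_primes K = {P. primeideal P (ring_of_integers K) \<and> P \<noteq> {0}}"

definition lies_over :: "'a::field_char_0 set \<Rightarrow> nat \<Rightarrow> bool" where
  "lies_over P p \<longleftrightarrow> P \<inter> \<int> = range (\<lambda>k::int. of_nat p * of_int k)"

definition prime_below :: "'a::field_char_0 set \<Rightarrow> nat" where
  "prime_below P = (THE p. prime p \<and> lies_over P p)"

definition num_primes_over :: "nat \<Rightarrow> 'a::field_char_0 set \<Rightarrow> nat" where
  "num_primes_over p K = card {P \<in> nonzero_primes K. lies_over P p}"

text \<open>The largest \<open>k\<close> with \<open>a \<in> P\<^sup>k\<close>, meaningful for nonzero integral \<open>a\<close>.\<close>

definition ord_integral :: "'a::field_char_0 set \<Rightarrow> 'a set \<Rightarrow> 'a \<Rightarrow> nat" where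
  "ord_integral K P a = Max {k. a \<in> P [^]\<^bsub>ideals_set (ring_of_integers K)\<^esub> k}"

text \<open>
  The valuation with value group \<open>\<int>\<close>, extended from the integers to \<open>K\<close> by
  \<open>ord (a / b) = ord a - ord b\<close>, meaningful for nonzero \<open>x\<close>.
\<close>

definition ord_at :: "'a::field_char_0 set \<Rightarrow> 'a set \<Rightarrow> 'a \<Rightarrow> int" where
  "ord_at K P x = (THE n. \<exists>a \<in> carrier (ring_of_integers K) - {0}.
     \<exists>b \<in> carrier (ring_of_integers K) - {0}.
       x = a / b \<and> n = int (ord_integral K P a) - int (ord_integral K P b))"

text \<open>Rescaled so that the rational prime below \<open>P\<close> has valuation 1.\<close>

definition val_at :: "'a::field_char_0 set \<Rightarrow> 'a set \<Rightarrow> 'a \<Rightarrow> rat" where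
  "val_at K P x = of_int (ord_at K P x) / of_int (ord_at K P (of_nat (prime_below P)))"

definition arith_ld :: "'a::field_char_0 set \<Rightarrow> 'a \<Rightarrow> rat" where
  "arith_ld K x = (\<Sum>P | P \<in> nonzero_primes K \<and> val_at K P x \<noteq> 0.
     val_at K P x / (of_nat (prime_below P) * of_nat (num_primes_over (prime_below P) K)))"

definition arith_deriv :: "'a::field_char_0 set \<Rightarrow> 'a \<Rightarrow> 'a" where
  "arith_deriv K x = x * of_rat (\<Sum>P | P \<in> nonzero_primes K \<and> val_at K P x \<noteq> 0.
     val_at K P x / (of_nat (prime_below P) * of_nat (num_primes_over (prime_below P) K)))"

lemma arith_ld_eq_arith_deriv_div: "x \<noteq> 0 \<Longrightarrow> of_rat (arith_ld K x) = arith_deriv K x / x"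
  by (simp add: arith_ld_def arith_deriv_def)

definition rat_group :: "rat monoid" where
  "rat_group = \<lparr>carrier = UNIV, monoid.mult = (+), one = 0\<rparr>"

end

theory Submission
  imports Defs "Jordan_Normal_Form.Char_Poly"
begin

text \<open>
  Let \<open>A\<close> be the group generated by the reciprocals of the primes and \<open>H\<close> the image of \<open>ld\<close>. As
  \<open>ld p = 1 / p\<close>, \<open>A \<subseteq> H\<close>. The automorphisms permute the primes above each \<open>p\<close>, so \<open>ld\<close> is constant on
  the set of conjugates of \<open>x\<close>; the product of these \<open>c\<close> conjugates is rational, whence \<open>c ld x \<in> A\<close>
  and \<open>n! H \<subseteq> A\<close> when \<open>n\<close> elements span \<open>K\<close> over \<open>\<rat>\<close>, as then \<open>c \<le> n\<close>.
  Every group between \<open>A\<close> and \<open>(1 / n!) A\<close> has the form \<open>(1 / m) A\<close>, because it can exceed \<open>A\<close> only by containing some \<open>1 / p\<^sup>2\<close>.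

  That the valuations are homomorphisms is obtained from \<open>u P \<subseteq> \<pi> \<O>\<close> for some \<open>u \<notin> P\<close> and
  \<open>\<pi> \<in> P\<close>, which needs only that \<open>\<O> / p\<O>\<close> is finite and that \<open>\<O>\<close> is integrally closed.
\<close>

section \<open>Sums and products of algebraic integers\<close>

text \<open>\<open>H\<close> can be strictly larger than \<open>A\<close>: in Q(i) the element 1 + i
  has normalized valuation 1/2 at the only prime over 2, so its logarithmic derivative is 1/4. Hence
  one gets an isomorphism and in general no equality. The excess comes from ramification and from
  the numbers g(p, K); one integer that carries \<open>H\<close> into \<open>A\<close> captures all
  that matters about it. Two obstacles shape the preparation. Automorphisms are total functions with
  arbitrary values outside \<open>K\<close>, so they may be infinitely many, and a product over all
  of them may be meaningless; the set of distinct conjugates replaces them, at the price of a factor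
  c that varies with x. For the valuations, localization at P is done by hand: equations hold up to
  a multiplier outside P. Finiteness of \<open>\<O> / p\<O>\<close> comes from a bound on the size
  of sets independent modulo p, and it supplies maximality of P, nilpotence modulo p near P, and the
  primes above p.\<close>

interpretation int_span: Modules.module "\<lambda>(c::int) (x::'a::field_char_0). of_int c * x"
  by unfold_locales (auto simp: algebra_simps)

interpretation rat_span: Vector_Spaces.vector_space "\<lambda>(q::rat) (x::'a::field_char_0). of_rat q * x"
  by unfold_locales (auto simp: algebra_simps of_rat_add of_rat_mult)

text \<open>Determinant trick: the elements of \<open>B\<close>, listed as a vector, form an
  eigenvector with eigenvalue \<open>x\<close> of an integer matrix, whose characteristic polynomial
  is monic with integer coefficients. \<open>B\<close> may be linearly dependent; a nonzero entry is
  enough for the vector to be an eigenvector.\<close>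

lemma algebraic_int_if_stabilizes_int_span:
  fixes x :: "'a::field_char_0"
  assumes fin: "finite B" and nz: "B \<noteq> {}" "B \<noteq> {0}"
    and stable: "\<And>b. b \<in> B \<Longrightarrow> x * b \<in> int_span.span B"
  shows "algebraic_int x"
proof -
  obtain h where h: "bij_betw h {0..<card B} B"
    using ex_bij_betw_nat_finite[OF fin] by blast
  define n where "n = card B"
  have hB: "h i \<in> B" if "i < n" for i
    using h that by (auto simp: n_def bij_betw_def)
  have "\<forall>i. \<exists>c. i < n \<longrightarrow> x * h i = (\<Sum>j<n. of_int (c j) * h j)"
  proof
    fix i
    show "\<exists>c. i < n \<longrightarrow> x * h i = (\<Sum>j<n. of_int (c j) * h j)"
    proof (cases "i < n")
      case True
      obtain c where c: "x * h i = (\<Sum>b\<in>B. of_int (c b) * b)"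
        using stable[OF hB[OF True]] by (auto simp: int_span.span_finite[OF fin])
      have "x * h i = (\<Sum>j<n. of_int (c (h j)) * h j)"
        unfolding c using sum.reindex_bij_betw[OF h, of "\<lambda>b. of_int (c b) * b"]
        by (simp add: n_def atLeast0LessThan)
      thus ?thesis by (intro exI[of _ "\<lambda>j. c (h j)"]) simp
    qed auto
  qed
  then obtain c where c: "\<And>i. i < n \<Longrightarrow> x * h i = (\<Sum>j<n. of_int (c i j) * h j)"
    by metis
  define A where "A = mat n n (\<lambda>(i, j). c i j)"
  have A: "A \<in> carrier_mat n n"
    by (simp add: A_def)
  define A' :: "'a mat" where "A' = map_mat of_int A"
  have A': "A' \<in> carrier_mat n n"
    using A by (simp add: A'_def)
  define v where "v = vec n h"
  obtain b where b: "b \<in> B" "b \<noteq> 0"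
    using nz by auto
  then obtain i where i: "i < n" "h i = b"
    using h by (metis atLeastLessThan_iff bij_betw_def imageE n_def)
  have "v \<noteq> 0\<^sub>v n"
  proof
    assume "v = 0\<^sub>v n"
    hence "v $ i = 0\<^sub>v n $ i" by simp
    thus False using i b by (simp add: v_def)
  qed
  moreover have "A' *\<^sub>v v = x \<cdot>\<^sub>v v"
    by (rule eq_vecI) (auto simp: A'_def A_def v_def scalar_prod_def c atLeast0LessThan)
  ultimately have "eigenvector A' v x"
    using A' by (auto simp: eigenvector_def v_def)
  hence "poly (char_poly A') x = 0"
    using eigenvalue_root_char_poly[OF A'] by (auto simp: eigenvalue_def)
  moreover have "char_poly A' = map_poly of_int (char_poly A)"
    unfolding A'_def by (rule of_int_hom.char_poly_hom[OF A])
  moreover have "lead_coeff (char_poly A) = 1"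
    using degree_monic_char_poly[OF A] by simp
  ultimately show ?thesis
    unfolding algebraic_int_altdef_ipoly by auto
qed

lemma int_span_mult_closed:
  fixes x :: "'a::field_char_0"
  assumes "\<And>b. b \<in> B \<Longrightarrow> x * b \<in> int_span.span B" and "a \<in> int_span.span B"
  shows "x * a \<in> int_span.span B"
  using assms(2)
proof (induction rule: int_span.span_induct_alt)
  case base
  then show ?case by (simp add: int_span.span_zero)
next
  case (step c y z)
  have "x * (of_int c * y + z) = of_int c * (x * y) + x * z"
    by (simp add: algebra_simps)
  thus ?case
    using int_span.span_add int_span.span_scale step assms(1) by metis
qed

lemma power_degree_int_combination:
  fixes x :: "'a::field_char_0"
  assumes "algebraic_int x"
  obtains m and c :: "nat \<Rightarrow> int" where "m > 0" "x ^ m = (\<Sum>i<m. of_int (c i) * x ^ i)"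
proof -
  obtain p where p: "poly (map_poly of_int p) x = 0" "lead_coeff p = 1"
    using assms by (auto simp: algebraic_int_altdef_ipoly)
  define m where "m = degree p"
  have "m > 0"
  proof (rule ccontr)
    assume "\<not> m > 0"
    then obtain a where "p = [:a:]" by (metis degree_eq_zeroE m_def gr0I)
    thus False using p by (auto simp: map_poly_pCons)
  qed
  have "0 = (\<Sum>i\<le>m. of_int (coeff p i) * x ^ i)"
    using p by (simp add: poly_altdef m_def coeff_map_poly degree_map_poly)
  also have "\<dots> = (\<Sum>i<m. of_int (coeff p i) * x ^ i) + x ^ m"
    using p by (simp add: m_def lessThan_Suc_atMost[symmetric])
  finally have "x ^ m = (\<Sum>i<m. of_int (- coeff p i) * x ^ i)"
    by (simp add: sum_negf eq_neg_iff_add_eq_0 add.commute)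
  thus ?thesis using that[of m "\<lambda>i. - coeff p i"] \<open>m > 0\<close> by simp
qed

text \<open>One finite set serves both claims: the monomials \<open>x ^ i * y ^ j\<close> below the
  degrees of monic relations for \<open>x\<close> and \<open>y\<close>. Its integer span is stable
  under multiplication by \<open>x\<close> and by \<open>y\<close>, hence by their sum and
  product.\<close>

lemma
  fixes x y :: "'a::field_char_0"
  assumes "algebraic_int x" "algebraic_int y"
  shows algebraic_int_add: "algebraic_int (x + y)"
    and algebraic_int_mult: "algebraic_int (x * y)"
proof -
  obtain m c where m: "m > 0" "x ^ m = (\<Sum>i<m. of_int (c i) * x ^ i)"
    using power_degree_int_combination[OF assms(1)] by blast
  obtain n d where n: "n > 0" "y ^ n = (\<Sum>i<n. of_int (d i) * y ^ i)"
    using power_degree_int_combination[OF assms(2)] by blast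
  define B where "B = (\<lambda>(i, j). x ^ i * y ^ j) ` ({..<m} \<times> {..<n})"
  have fin: "finite B" by (simp add: B_def)
  have inB: "x ^ i * y ^ j \<in> B" if "i < m" "j < n" for i j
    using that by (auto simp: B_def)
  have "1 \<in> B" using inB[of 0 0] m n by simp
  hence nz: "B \<noteq> {}" "B \<noteq> {0}" by auto
  have xB: "x * b \<in> int_span.span B" if bB: "b \<in> B" for b
  proof -
    obtain i j where ij: "i < m" "j < n" "b = x ^ i * y ^ j"
      using bB by (auto simp: B_def)
    show ?thesis
    proof (cases "Suc i = m")
      case True
      have "x * b = x ^ m * y ^ j"
        using ij True by (auto simp: algebra_simps)
      also have "\<dots> = (\<Sum>i<m. of_int (c i) * (x ^ i * y ^ j))"
        unfolding m sum_distrib_right by (simp only: mult_ac)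
      also have "\<dots> \<in> int_span.span B"
        using ij inB by (intro int_span.span_sum int_span.span_scale int_span.span_base) auto
      finally show ?thesis .
    next
      case False
      hence "x ^ Suc i * y ^ j \<in> B" using ij by (intro inB) auto
      moreover have "x * b = x ^ Suc i * y ^ j" using ij by simp
      ultimately show ?thesis by (simp only: int_span.span_base)
    qed
  qed
  have yB: "y * b \<in> int_span.span B" if bB: "b \<in> B" for b
  proof -
    obtain i j where ij: "i < m" "j < n" "b = x ^ i * y ^ j"
      using bB by (auto simp: B_def)
    show ?thesis
    proof (cases "Suc j = n")
      case True
      have "y * b = x ^ i * y ^ n"
        using ij True by (auto simp: algebra_simps)
      also have "\<dots> = (\<Sum>j<n. of_int (d j) * (x ^ i * y ^ j))"
        unfolding n sum_distrib_left by (simp only: mult_ac)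
      also have "\<dots> \<in> int_span.span B"
        using ij inB by (intro int_span.span_sum int_span.span_scale int_span.span_base) auto
      finally show ?thesis .
    next
      case False
      hence "x ^ i * y ^ Suc j \<in> B" using ij by (intro inB) auto
      moreover have "y * b = x ^ i * y ^ Suc j" using ij by simp
      ultimately show ?thesis by (simp only: int_span.span_base)
    qed
  qed
  show "algebraic_int (x + y)"
    by (rule algebraic_int_if_stabilizes_int_span[OF fin nz])
       (auto simp: distrib_right intro: int_span.span_add xB yB)
  show "algebraic_int (x * y)"
    by (rule algebraic_int_if_stabilizes_int_span[OF fin nz])
       (auto simp: mult.assoc intro: int_span_mult_closed xB yB)
qed

section \<open>Galois number fields\<close>

lemma common_denominator:
  fixes u :: "'b \<Rightarrow> rat"
  assumes "finite S"
  obtains d :: int and c :: "'b \<Rightarrow> int"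
  where "d > 0" "\<And>v. v \<in> S \<Longrightarrow> of_int (c v) = of_int d * u v"
proof -
  have "\<exists>d::int. d > 0 \<and> (\<forall>v\<in>S. \<exists>k::int. of_int k = of_int d * u v)"
    using assms
  proof (induction S rule: finite_induct)
    case empty
    show ?case by (auto intro: exI[of _ 1])
  next
    case (insert x S)
    then obtain d :: int where d: "d > 0" "\<forall>v\<in>S. \<exists>k::int. of_int k = of_int d * u v"
      by blast
    obtain a b where ab: "b > 0" "u x = of_int a / of_int b"
      using quotient_of_div quotient_of_denom_pos by (cases "quotient_of (u x)") blast
    have "\<exists>k::int. of_int k = of_int (d * b) * u v" if v: "v \<in> insert x S" for v
    proof (cases "v = x")
      case True
      have "of_int (d * a) = of_int (d * b) * u x" using ab by simp
      thus ?thesis using True by blast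
    next
      case False
      then obtain k :: int where "of_int k = of_int d * u v"
        using d v by blast
      hence "of_int (k * b) = of_int (d * b) * u v" by simp
      thus ?thesis by blast
    qed
    thus ?case using d ab by (intro exI[of _ "d * b"]) auto
  qed
  then obtain d :: int where d: "d > 0" "\<forall>v\<in>S. \<exists>k::int. of_int k = of_int d * u v"
    by blast
  from bchoice[OF d(2)] show ?thesis using that d(1) by blast
qed

lemma rat_dependent_imp_int_relation:
  fixes S :: "'a::field_char_0 set"
  assumes "finite S" "rat_span.dependent S"
  obtains c :: "'a \<Rightarrow> int" and v where "v \<in> S" "c v \<noteq> 0" "(\<Sum>w\<in>S. of_int (c w) * w) = 0"
proof -
  obtain u v where u: "v \<in> S" "u v \<noteq> 0" "(\<Sum>w\<in>S. of_rat (u w) * w) = 0"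
    using assms(2) unfolding rat_span.dependent_finite[OF assms(1)] by blast
  obtain d :: int and c where d: "d > 0" "\<And>v. v \<in> S \<Longrightarrow> of_int (c v) = of_int d * u v"
    using common_denominator[OF assms(1)] by blast
  have c: "(of_int (c w) :: 'a) = of_int d * of_rat (u w)" if "w \<in> S" for w
    using d(2)[OF that, THEN arg_cong[where f = of_rat]] by (simp add: of_rat_mult)
  have "(\<Sum>w\<in>S. of_int (c w) * w) = of_int d * (\<Sum>w\<in>S. of_rat (u w) * w)"
    unfolding sum_distrib_left by (intro sum.cong) (auto simp: c)
  also have "\<dots> = 0" using u(3) by simp
  finally have "(\<Sum>w\<in>S. of_int (c w) * w) = 0" .
  moreover have "c v \<noteq> 0" using d(2)[OF u(1)] d(1) u(2) by auto
  ultimately show ?thesis using that[OF u(1)] by simp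
qed

lemma int_relation_in_rat_span:
  fixes f :: "nat \<Rightarrow> 'a::field_char_0"
  assumes "finite B" "\<And>i. i \<le> card B \<Longrightarrow> f i \<in> rat_span.span B"
  obtains c :: "nat \<Rightarrow> int" and i
  where "i \<le> card B" "c i \<noteq> 0" "(\<Sum>i\<le>card B. of_int (c i) * f i) = 0"
proof (cases "inj_on f {..card B}")
  case True
  have "rat_span.dependent (f ` {..card B})"
    using rat_span.independent_span_bound[OF assms(1), of "f ` {..card B}"] assms(2)
    by (auto simp: card_image[OF True])
  then obtain c :: "'a \<Rightarrow> int" and v where c: "v \<in> f ` {..card B}" "c v \<noteq> 0"
    "(\<Sum>w\<in>f ` {..card B}. of_int (c w) * w) = 0"
    by (rule rat_dependent_imp_int_relation[OF finite_imageI[OF finite_atMost]])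
  obtain i where "i \<le> card B" "v = f i" using c(1) by blast
  moreover have "(\<Sum>i\<le>card B. of_int (c (f i)) * f i) = 0"
    using c(3) by (simp add: sum.reindex[OF True])
  ultimately show ?thesis using that[of i "\<lambda>i. c (f i)"] c(2) by simp
next
  \<comment> \<open>Dependence is a property of sets and is silent about repeated values; a
    repetition gives a relation with coefficients 1 and -1 directly.\<close>
  case False
  then obtain i j where ij: "i \<le> card B" "j \<le> card B" "i \<noteq> j" "f i = f j"
    by (auto simp: inj_on_def)
  define c :: "nat \<Rightarrow> int" where "c = (\<lambda>k. if k = i then 1 else if k = j then -1 else 0)"
  have "(\<Sum>k\<le>card B. of_int (c k) * f k) = (\<Sum>k\<in>{i, j}. of_int (c k) * f k)"
    using ij by (intro sum.mono_neutral_right) (auto simp: c_def)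
  also have "\<dots> = 0" using ij by (simp add: c_def)
  finally show ?thesis using that[of i c] ij by (simp add: c_def)
qed

lemma algebraic_int_if_power_eq:
  fixes y :: "'a::field_char_0"
  assumes "m > 0" "y ^ m = (\<Sum>i<m. of_int (c i) * y ^ i)"
  shows "algebraic_int y"
proof (rule algebraic_int_if_stabilizes_int_span)
  let ?B = "(\<lambda>i. y ^ i) ` {..<m}"
  show "finite ?B" by simp
  have one: "1 \<in> ?B" using assms(1) by (intro image_eqI[of _ _ 0]) auto
  show "?B \<noteq> {}" "?B \<noteq> {0}" using one by (metis empty_iff, metis one singletonD one_neq_zero)
  fix b assume "b \<in> ?B"
  then obtain i where i: "i < m" "b = y ^ i" by blast
  show "y * b \<in> int_span.span ?B"
  proof (cases "Suc i = m")
    case True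
    have "y * b = y ^ m" using i True by auto
    also have "\<dots> = (\<Sum>i<m. of_int (c i) * y ^ i)" by (rule assms(2))
    also have "\<dots> \<in> int_span.span ?B"
      by (intro int_span.span_sum int_span.span_scale int_span.span_base) auto
    finally show ?thesis .
  next
    case False
    hence "y * b \<in> ?B" using i by (intro image_eqI[of _ _ "Suc i"]) auto
    thus ?thesis by (rule int_span.span_base)
  qed
qed

text \<open>Multiplying a relation of degree \<open>k\<close> by the power \<open>k - 1\<close> of
  its leading coefficient makes it a monic relation for the leading coefficient times
  \<open>x\<close>. As \<open>n\<close> only bounds the degree, \<open>k\<close> is taken as the
  last index with a nonzero coefficient.\<close>

lemma int_multiple_algebraic_int:
  fixes x :: "'a::field_char_0"
  assumes "i \<le> n" "c i \<noteq> (0::int)" "(\<Sum>i\<le>n. of_int (c i) * x ^ i) = 0"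
  obtains m :: int where "m \<noteq> 0" "algebraic_int (of_int m * x)"
proof -
  define k where "k = Max {i. i \<le> n \<and> c i \<noteq> 0}"
  have "k \<in> {i. i \<le> n \<and> c i \<noteq> 0}"
    unfolding k_def using assms by (intro Max_in) auto
  hence k: "k \<le> n" "c k \<noteq> 0" by auto
  have above: "c j = 0" if "k < j" "j \<le> n" for j
  proof (rule ccontr)
    assume "c j \<noteq> 0"
    hence "j \<le> k" unfolding k_def using that by (intro Max_ge) auto
    thus False using that by simp
  qed
  have "(\<Sum>i\<le>n. of_int (c i) * x ^ i) = (\<Sum>i\<le>k. of_int (c i) * x ^ i)"
    using k above by (intro sum.mono_neutral_right) auto
  hence rel: "(\<Sum>i<k. of_int (c i) * x ^ i) + of_int (c k) * x ^ k = 0"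
    using assms(3) by (simp add: lessThan_Suc_atMost[symmetric])
  have "k > 0"
  proof (rule ccontr)
    assume "\<not> k > 0"
    thus False using rel k by simp
  qed
  have "(of_int (c k) * x) ^ k = of_int (c k) ^ (k - 1) * (of_int (c k) * x ^ k)"
    using \<open>k > 0\<close> by (cases k) (auto simp: power_mult_distrib)
  also have "of_int (c k) * x ^ k = - (\<Sum>i<k. of_int (c i) * x ^ i)"
    using rel by (simp add: eq_neg_iff_add_eq_0 add.commute)
  also have "of_int (c k) ^ (k - 1) * \<dots>
      = (\<Sum>i<k. of_int (- c i * c k ^ (k - 1 - i)) * (of_int (c k) * x) ^ i)"
    unfolding sum_negf[symmetric] sum_distrib_left
  proof (intro sum.cong refl)
    fix i assume "i \<in> {..<k}"
    hence "of_int (c k) ^ (k - 1) = (of_int (c k) ^ (k - 1 - i) * of_int (c k) ^ i :: 'a)"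
      by (simp add: power_add[symmetric])
    thus "of_int (c k) ^ (k - 1) * - (of_int (c i) * x ^ i)
        = of_int (- c i * c k ^ (k - 1 - i)) * (of_int (c k) * x) ^ i"
      by (simp add: power_mult_distrib mult_ac)
  qed
  finally have "algebraic_int (of_int (c k) * x)"
    by (rule algebraic_int_if_power_eq[OF \<open>k > 0\<close>])
  thus ?thesis using that[OF k(2)] by simp
qed

lemma coeff_linear_mult:
  "coeff ([:- z, 1:] * q) i = (case i of 0 \<Rightarrow> 0 | Suc j \<Rightarrow> coeff q j) - z * coeff q i"
  for z :: "'b::comm_ring_1"
  by (simp add: mult_pCons_left coeff_pCons split: nat.split)

lemma bezout_prime:
  fixes m :: int
  assumes "prime p" "\<not> int p dvd m"
  obtains a b where "a * m + b * int p = 1"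
proof -
  have "gcd (int p) m = 1"
    using assms prime_imp_coprime[of "int p" m] by (simp add: coprime_iff_gcd_eq_1)
  thus ?thesis using bezout_int[of m "int p"] that by (metis gcd.commute)
qed

section \<open>Closure properties of the field and of its integers\<close>

locale galois_number_field =
  fixes K :: "'a::field_char_0 set"
  assumes galois: "finite_Galois_over_Q K"
begin

definition ints ("\<O>") where "\<O> = {x \<in> K. algebraic_int x}"

lemma carrier_ring_of_integers [simp]: "carrier (ring_of_integers K) = \<O>"
  by (simp add: ring_of_integers_def ring_on_def ints_def)

lemma ops_ring_of_integers [simp]:
  "monoid.mult (ring_of_integers K) = (*)" "one (ring_of_integers K) = 1"
  "zero (ring_of_integers K) = 0" "add (ring_of_integers K) = (+)"
  by (auto simp: ring_of_integers_def ring_on_def)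

lemma field_K: "field (ring_on K)"
  using galois by (simp add: finite_Galois_over_Q_def finite_over_Q_def)

lemma K_zero [simp]: "0 \<in> K" and K_one [simp]: "1 \<in> K"
  and K_add: "x \<in> K \<Longrightarrow> y \<in> K \<Longrightarrow> x + y \<in> K"
  and K_mult: "x \<in> K \<Longrightarrow> y \<in> K \<Longrightarrow> x * y \<in> K"
proof -
  interpret R: field "ring_on K" by (rule field_K)
  show "0 \<in> K" "1 \<in> K" "x \<in> K \<Longrightarrow> y \<in> K \<Longrightarrow> x + y \<in> K" "x \<in> K \<Longrightarrow> y \<in> K \<Longrightarrow> x * y \<in> K"
    using R.zero_closed R.one_closed R.a_closed[of x y] R.m_closed[of x y]
    by (auto simp: ring_on_def)
qed

lemma K_inverse: assumes "x \<in> K" shows "inverse x \<in> K"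
proof (cases "x = 0")
  case False
  interpret R: field "ring_on K" by (rule field_K)
  have "x \<in> Units (ring_on K)" using False assms R.field_Units by (simp add: ring_on_def)
  then obtain y where "y \<in> K" "y * x = 1"
    by (auto simp: Units_def ring_on_def)
  moreover from this have "y = inverse x"
    using False by (simp add: field_simps)
  ultimately show ?thesis by simp
qed auto

lemma Rats_subset_K: "\<rat> \<subseteq> K"
  using galois by (auto simp: finite_Galois_over_Q_def)

lemma K_of_int [simp]: "of_int m \<in> K" and K_of_nat [simp]: "of_nat k \<in> K"
  using Rats_subset_K by auto

lemma K_uminus: "x \<in> K \<Longrightarrow> - x \<in> K"
  using K_mult[of "of_int (-1)" x] K_of_int[of "-1"] by simp

lemma K_diff: "x \<in> K \<Longrightarrow> y \<in> K \<Longrightarrow> x - y \<in> K"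
  using K_add[of x "- y"] K_uminus by simp

lemma K_divide: "x \<in> K \<Longrightarrow> y \<in> K \<Longrightarrow> x / y \<in> K"
  by (simp add: divide_inverse K_mult K_inverse)

lemma K_power: "x \<in> K \<Longrightarrow> x ^ n \<in> K"
  by (induction n) (auto intro: K_mult)

lemma K_prod: "(\<And>x. x \<in> S \<Longrightarrow> f x \<in> K) \<Longrightarrow> prod f S \<in> K"
  by (induction S rule: infinite_finite_induct) (auto intro: K_mult)

lemma ints_K: "x \<in> \<O> \<Longrightarrow> x \<in> K"
  by (simp add: ints_def)

lemma ints_zero [simp]: "0 \<in> \<O>" and ints_one [simp]: "1 \<in> \<O>"
  and ints_of_int [simp]: "of_int m \<in> \<O>" and ints_of_nat [simp]: "of_nat k \<in> \<O>"
  and ints_add: "x \<in> \<O> \<Longrightarrow> y \<in> \<O> \<Longrightarrow> x + y \<in> \<O>"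
  and ints_mult: "x \<in> \<O> \<Longrightarrow> y \<in> \<O> \<Longrightarrow> x * y \<in> \<O>"
  and ints_uminus: "x \<in> \<O> \<Longrightarrow> - x \<in> \<O>"
  by (auto simp: ints_def K_add K_mult K_uminus algebraic_int_add algebraic_int_mult)

lemma ints_diff: "x \<in> \<O> \<Longrightarrow> y \<in> \<O> \<Longrightarrow> x - y \<in> \<O>"
  using ints_add[of x "- y"] ints_uminus by simp

lemma ints_power: "x \<in> \<O> \<Longrightarrow> x ^ n \<in> \<O>"
  by (induction n) (auto intro: ints_mult)

lemma ints_sum: "(\<And>x. x \<in> S \<Longrightarrow> f x \<in> \<O>) \<Longrightarrow> sum f S \<in> \<O>"
  by (induction S rule: infinite_finite_induct) (auto intro: ints_add)

lemma ints_prod: "(\<And>x. x \<in> S \<Longrightarrow> f x \<in> \<O>) \<Longrightarrow> prod f S \<in> \<O>"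
  by (induction S rule: infinite_finite_induct) (auto intro: ints_mult)

lemma ints_rational: "x \<in> \<O> \<Longrightarrow> x \<in> \<rat> \<Longrightarrow> x \<in> \<int>"
  by (auto simp: ints_def rational_algebraic_int_is_int)

text \<open>Fixed once, so that its cardinality is a uniform bound: for the degree of an integer
  relation of any element of \<open>K\<close>, and through it for the number of conjugates.\<close>

definition spanning_set where
  "spanning_set = (SOME B. finite B \<and> K = rat_span.span B)"

lemma spanning_set: "finite spanning_set" "K = rat_span.span spanning_set"
proof -
  have "\<exists>B. finite B \<and> K = rat_span.span B"
    using galois by (auto simp: finite_Galois_over_Q_def finite_over_Q_def)
  from someI_ex[OF this] show "finite spanning_set" "K = rat_span.span spanning_set"
    by (simp_all add: spanning_set_def)
qed

lemma K_int_relation: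
  assumes "x \<in> K"
  obtains c :: "nat \<Rightarrow> int" and i
  where "i \<le> card spanning_set" "c i \<noteq> 0" "(\<Sum>i\<le>card spanning_set. of_int (c i) * x ^ i) = 0"
proof (rule int_relation_in_rat_span[OF spanning_set(1), of "\<lambda>i. x ^ i"])
  show "x ^ i \<in> rat_span.span spanning_set" for i
    using K_power[OF assms] spanning_set(2) by simp
qed (use that in blast)

lemma K_eq_fraction:
  assumes "x \<in> K"
  obtains m :: int where "m \<noteq> 0" "of_int m * x \<in> \<O>"
proof -
  obtain c :: "nat \<Rightarrow> int" and i
    where c: "i \<le> card spanning_set" "c i \<noteq> 0" "(\<Sum>i\<le>card spanning_set. of_int (c i) * x ^ i) = 0"
    using K_int_relation[OF assms] by blast
  obtain m :: int where "m \<noteq> 0" "algebraic_int (of_int m * x)"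
    using int_multiple_algebraic_int[OF c] by blast
  thus ?thesis using that assms by (auto simp: ints_def K_mult)
qed

section \<open>Automorphisms, conjugates and their product\<close>

abbreviation G where "G \<equiv> Aut_over_Q K"

context
  fixes \<sigma> assumes \<sigma>: "\<sigma> \<in> G"
begin

lemma aut_closed: "x \<in> K \<Longrightarrow> \<sigma> x \<in> K"
  and aut_mult: "x \<in> K \<Longrightarrow> y \<in> K \<Longrightarrow> \<sigma> (x * y) = \<sigma> x * \<sigma> y"
  and aut_add: "x \<in> K \<Longrightarrow> y \<in> K \<Longrightarrow> \<sigma> (x + y) = \<sigma> x + \<sigma> y"
  and aut_bij: "bij_betw \<sigma> K K"
  and aut_rat: "x \<in> \<rat> \<Longrightarrow> \<sigma> x = x"
  using \<sigma> by (auto simp: Aut_over_Q_def ring_iso_def Ring.ring_hom_def ring_on_def)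

lemma aut_of_int: "\<sigma> (of_int m) = of_int m"
  and aut_of_nat: "\<sigma> (of_nat k) = of_nat k"
  and aut_0: "\<sigma> 0 = 0" and aut_1: "\<sigma> 1 = 1"
  by (auto intro: aut_rat)

lemma aut_inj: "x \<in> K \<Longrightarrow> y \<in> K \<Longrightarrow> \<sigma> x = \<sigma> y \<longleftrightarrow> x = y"
  using aut_bij by (auto simp: bij_betw_def inj_on_def)

lemma aut_eq_0: "x \<in> K \<Longrightarrow> \<sigma> x = 0 \<longleftrightarrow> x = 0"
  using aut_inj[of x 0] by (simp add: aut_0)

lemma aut_uminus: "x \<in> K \<Longrightarrow> \<sigma> (- x) = - \<sigma> x"
  using aut_mult[of "of_int (-1)" x] K_of_int[of "-1"] aut_of_int[of "-1"] by simp

lemma aut_diff: "x \<in> K \<Longrightarrow> y \<in> K \<Longrightarrow> \<sigma> (x - y) = \<sigma> x - \<sigma> y"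
  using aut_add[of x "- y"] aut_uminus[of y] K_uminus by simp

lemma aut_divide: assumes "x \<in> K" "y \<in> K" shows "\<sigma> (x / y) = \<sigma> x / \<sigma> y"
proof (cases "y = 0")
  case False
  have "\<sigma> (x / y) * \<sigma> y = \<sigma> x"
    using aut_mult[of "x / y" y] assms False K_divide by simp
  thus ?thesis using aut_eq_0[OF assms(2)] False by (simp add: field_simps)
qed (simp add: aut_0)

lemma aut_power: "x \<in> K \<Longrightarrow> \<sigma> (x ^ n) = \<sigma> x ^ n"
  by (induction n) (auto simp: aut_1 aut_mult K_power)

lemma aut_prod:
  assumes "S \<subseteq> K"
  shows "\<sigma> (\<Prod>S) = (\<Prod>x\<in>S. \<sigma> x)"
  using assms by (induction S rule: infinite_finite_induct) (auto simp: aut_1 aut_mult K_prod subset_iff)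

lemma aut_int_poly:
  assumes "x \<in> K"
  shows "\<sigma> (\<Sum>i\<in>I. of_int (c i) * x ^ i) = (\<Sum>i\<in>I. of_int (c i) * \<sigma> x ^ i)"
proof -
  have "(\<Sum>i\<in>I. of_int (c i) * x ^ i) \<in> K \<and> ?thesis"
    using assms by (induction I rule: infinite_finite_induct)
      (auto simp: aut_0 aut_of_int aut_add aut_mult aut_power K_add K_mult K_power)
  thus ?thesis ..
qed

lemma aut_algebraic_int:
  assumes "x \<in> \<O>"
  shows "\<sigma> x \<in> \<O>"
proof -
  obtain m and c :: "nat \<Rightarrow> int" where m: "m > 0" "x ^ m = (\<Sum>i<m. of_int (c i) * x ^ i)"
    using power_degree_int_combination[of x] assms unfolding ints_def by blast
  have "\<sigma> x ^ m = (\<Sum>i<m. of_int (c i) * \<sigma> x ^ i)"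
    using m aut_int_poly[of x c "{..<m}"] aut_power[of x m] ints_K[OF assms] by simp
  thus ?thesis
    using algebraic_int_if_power_eq[OF m(1)] aut_closed ints_K[OF assms] by (auto simp: ints_def)
qed

lemma aut_inverse:
  obtains \<tau> where "\<tau> \<in> G" "\<And>x. x \<in> K \<Longrightarrow> \<tau> (\<sigma> x) = x" "\<And>x. x \<in> K \<Longrightarrow> \<sigma> (\<tau> x) = x"
proof
  let ?\<tau> = "inv_into K \<sigma>"
  interpret R: field "ring_on K" by (rule field_K)
  have "\<sigma> \<in> ring_iso (ring_on K) (ring_on K)"
    using \<sigma> by (simp add: Aut_over_Q_def)
  hence "?\<tau> \<in> ring_iso (ring_on K) (ring_on K)"
    using ring_iso_set_sym[OF R.ring_axioms] by (simp add: ring_on_def)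
  moreover show inv: "?\<tau> (\<sigma> x) = x" if "x \<in> K" for x
    using that aut_bij by (simp add: bij_betw_def)
  moreover show "\<sigma> (?\<tau> x) = x" if "x \<in> K" for x
    using that aut_bij by (simp add: bij_betw_def f_inv_into_f)
  moreover have "?\<tau> x = x" if "x \<in> \<rat>" for x
    using that inv Rats_subset_K aut_rat by (metis subsetD)
  ultimately show "?\<tau> \<in> G" by (simp add: Aut_over_Q_def)
qed

lemma aut_comp:
  assumes "\<tau> \<in> G"
  shows "\<sigma> \<circ> \<tau> \<in> G"
  using \<sigma> assms by (auto simp: Aut_over_Q_def intro!: ring_iso_set_trans)

end

lemma aut_id: "id \<in> G"
  by (auto simp: Aut_over_Q_def ring_iso_def Ring.ring_hom_def ring_on_def)

lemma fixed_imp_rational: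
  assumes "x \<in> K" "\<And>\<sigma>. \<sigma> \<in> G \<Longrightarrow> \<sigma> x = x"
  shows "x \<in> \<rat>"
  using assms galois unfolding finite_Galois_over_Q_def by blast

text \<open>A set without multiplicities: different members of \<open>G\<close> may agree on
  \<open>K\<close>, so counting them carries no information about \<open>x\<close>.\<close>

definition conjugates where "conjugates x = (\<lambda>\<sigma>. \<sigma> x) ` G"

lemma conjugates_self: "x \<in> conjugates x"
  using imageI[OF aut_id, of "\<lambda>\<sigma>. \<sigma> x"] by (simp add: conjugates_def)

lemma conjugates_subset_K: "x \<in> K \<Longrightarrow> conjugates x \<subseteq> K"
  unfolding conjugates_def using aut_closed by blast

lemma conjugates_subset_ints: "x \<in> \<O> \<Longrightarrow> conjugates x \<subseteq> \<O>"
  unfolding conjugates_def using aut_algebraic_int by blast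

text \<open>A linear relation with integer coefficients among the powers of \<open>x\<close> is a
  nonzero polynomial of degree at most \<open>card spanning_set\<close>, and every conjugate is a
  root of it.\<close>

lemma conjugates_finite_card:
  assumes "x \<in> K"
  shows "finite (conjugates x) \<and> card (conjugates x) \<le> card spanning_set"
proof -
  obtain c :: "nat \<Rightarrow> int" and i
    where c: "i \<le> card spanning_set" "c i \<noteq> 0" "(\<Sum>i\<le>card spanning_set. of_int (c i) * x ^ i) = 0"
    using K_int_relation[OF assms] by blast
  define q :: "'a poly" where "q = (\<Sum>i\<le>card spanning_set. monom (of_int (c i)) i)"
  have "coeff q i = of_int (c i)"
    using c(1) by (simp add: q_def coeff_sum)
  hence q: "q \<noteq> 0" using c(2) by auto
  have deg: "degree q \<le> card spanning_set"
    unfolding q_def by (intro degree_sum_le) (auto intro: order_trans[OF degree_monom_le])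
  have "conjugates x \<subseteq> {y. poly q y = 0}"
  proof
    fix y assume "y \<in> conjugates x"
    then obtain \<sigma> where \<sigma>: "\<sigma> \<in> G" "y = \<sigma> x" by (auto simp: conjugates_def)
    have "poly q y = \<sigma> (\<Sum>i\<le>card spanning_set. of_int (c i) * x ^ i)"
      by (simp add: q_def poly_sum poly_monom \<sigma>(2) aut_int_poly[OF \<sigma>(1) assms])
    thus "y \<in> {y. poly q y = 0}" by (simp add: c(3) aut_0[OF \<sigma>(1)])
  qed
  thus ?thesis
    using card_mono[OF poly_roots_finite[OF q]] card_poly_roots_bound[OF q] deg
      poly_roots_finite[OF q] by (meson finite_subset order_trans)
qed

lemma conjugates_aut_bij:
  assumes "x \<in> K" "\<sigma> \<in> G"
  shows "bij_betw \<sigma> (conjugates x) (conjugates x)"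
proof -
  have inj: "inj_on \<sigma> (conjugates x)"
    using conjugates_subset_K[OF assms(1)] aut_inj[OF assms(2)] by (auto simp: inj_on_def subset_iff)
  have "\<sigma> ` conjugates x \<subseteq> conjugates x"
  proof
    fix y assume "y \<in> \<sigma> ` conjugates x"
    then obtain \<tau> where "\<tau> \<in> G" "y = (\<sigma> \<circ> \<tau>) x" by (auto simp: conjugates_def)
    thus "y \<in> conjugates x"
      using aut_comp[OF assms(2)] unfolding conjugates_def by blast
  qed
  thus ?thesis
    using endo_inj_surj[OF _ _ inj] conjugates_finite_card[OF assms(1)] inj
    by (auto simp: bij_betw_def)
qed

text \<open>An automorphism permutes the conjugates and so fixes their product; the fixed field is
  the rationals because the extension is Galois.\<close>

lemma prod_conjugates_rational:
  assumes "x \<in> K"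
  shows "\<Prod>(conjugates x) \<in> \<rat>"
proof (rule fixed_imp_rational)
  show "\<Prod>(conjugates x) \<in> K"
    using conjugates_subset_K[OF assms] by (auto intro: K_prod)
  fix \<sigma> assume \<sigma>: "\<sigma> \<in> G"
  show "\<sigma> (\<Prod>(conjugates x)) = \<Prod>(conjugates x)"
    using aut_prod[OF \<sigma> conjugates_subset_K[OF assms]]
      prod.reindex_bij_betw[OF conjugates_aut_bij[OF assms \<sigma>], of "\<lambda>x. x"] by simp
qed

lemma prod_conjugates_nonzero:
  assumes "x \<in> K" "x \<noteq> 0"
  shows "\<Prod>(conjugates x) \<noteq> 0"
proof -
  have "0 \<notin> conjugates x"
    using assms aut_eq_0 by (force simp: conjugates_def)
  thus ?thesis using conjugates_finite_card[OF assms(1)] by simp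
qed

text \<open>\<open>y\<close> is the product of the other conjugates, and the full product is a
  rational algebraic integer. This reduces questions about a nonzero element of \<open>\<O>\<close>
  to the prime factors of an integer.\<close>

lemma ints_multiple_int:
  assumes "x \<in> \<O>" "x \<noteq> 0"
  obtains m :: int and y where "m \<noteq> 0" "y \<in> \<O>" "of_int m = x * y"
proof -
  have K: "x \<in> K" using assms ints_K by blast
  let ?C = "conjugates x"
  have "\<Prod>?C \<in> \<O>" using conjugates_subset_ints[OF assms(1)] by (auto intro: ints_prod)
  then obtain m :: int where m: "\<Prod>?C = of_int m"
    using ints_rational prod_conjugates_rational[OF K] by (auto elim: Ints_cases)
  have "\<Prod>?C = x * \<Prod>(?C - {x})"
    using conjugates_self conjugates_finite_card[OF K] by (intro prod.remove) auto
  moreover have "\<Prod>(?C - {x}) \<in> \<O>"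
    using conjugates_subset_ints[OF assms(1)] by (auto intro: ints_prod)
  moreover have "m \<noteq> 0" using prod_conjugates_nonzero[OF K assms(2)] m by simp
  ultimately show ?thesis using that[of m "\<Prod>(?C - {x})"] m by simp
qed

end

section \<open>Almost integral elements and residues modulo a rational prime\<close>

context galois_number_field
begin

text \<open>Complete integrality: one common denominator for all powers. An element that maps a
  nonzero ideal into itself has this property at once, and the property passes to sums, products and
  images under automorphisms, hence to the coefficients of the polynomial whose roots are the
  conjugates.\<close>

definition almost_integral where
  "almost_integral x \<longleftrightarrow> x \<in> K \<and> (\<exists>m::int. m \<noteq> 0 \<and> (\<forall>k. of_int m * x ^ k \<in> \<O>))"

lemma almost_integralI:
  assumes "x \<in> K" "m \<noteq> 0" "\<And>k. of_int m * x ^ k \<in> \<O>"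
  shows "almost_integral x"
  using assms unfolding almost_integral_def by blast

lemma almost_integralE:
  assumes "almost_integral x"
  obtains m :: int where "x \<in> K" "m \<noteq> 0" "\<And>k. of_int m * x ^ k \<in> \<O>"
  using assms unfolding almost_integral_def by blast

lemma almost_integral_if_ints: "x \<in> \<O> \<Longrightarrow> almost_integral x"
  by (rule almost_integralI[of _ 1]) (simp_all add: ints_K ints_power)

lemma almost_integral_add:
  assumes "almost_integral x" "almost_integral y"
  shows "almost_integral (x + y)"
proof -
  obtain m :: int where m: "x \<in> K" "m \<noteq> 0" "\<And>k. of_int m * x ^ k \<in> \<O>"
    using assms(1) by (elim almost_integralE) blast
  obtain n :: int where n: "y \<in> K" "n \<noteq> 0" "\<And>k. of_int n * y ^ k \<in> \<O>"
    using assms(2) by (elim almost_integralE) blast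
  have "of_int (m * n) * (x + y) ^ k \<in> \<O>" for k
  proof -
    have "of_int (m * n) * (x + y) ^ k
        = (\<Sum>i\<le>k. of_nat (k choose i) * ((of_int m * x ^ i) * (of_int n * y ^ (k - i))))"
      unfolding binomial_ring sum_distrib_left by (intro sum.cong refl) (simp only: of_int_mult mult_ac)
    also have "\<dots> \<in> \<O>"
      by (intro ints_sum ints_mult[OF ints_of_nat ints_mult[OF m(3) n(3)]])
    finally show ?thesis .
  qed
  thus ?thesis
    using m(2) n(2) by (intro almost_integralI[OF K_add[OF m(1) n(1)], of "m * n"]) simp_all
qed

lemma almost_integral_mult:
  assumes "almost_integral x" "almost_integral y"
  shows "almost_integral (x * y)"
proof -
  obtain m :: int where m: "x \<in> K" "m \<noteq> 0" "\<And>k. of_int m * x ^ k \<in> \<O>"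
    using assms(1) by (elim almost_integralE) blast
  obtain n :: int where n: "y \<in> K" "n \<noteq> 0" "\<And>k. of_int n * y ^ k \<in> \<O>"
    using assms(2) by (elim almost_integralE) blast
  have "of_int (m * n) * (x * y) ^ k \<in> \<O>" for k
    using ints_mult[OF m(3)[of k] n(3)[of k]] by (simp only: power_mult_distrib of_int_mult mult_ac)
  thus ?thesis
    using m(2) n(2) by (intro almost_integralI[OF K_mult[OF m(1) n(1)], of "m * n"]) simp_all
qed

lemma almost_integral_uminus: "almost_integral x \<Longrightarrow> almost_integral (- x)"
  using almost_integral_mult[OF almost_integral_if_ints[OF ints_of_int[of "-1"]], of x] by simp

lemma almost_integral_aut:
  assumes "almost_integral x" "\<sigma> \<in> G"
  shows "almost_integral (\<sigma> x)"
proof -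
  obtain m :: int where K: "x \<in> K" and m: "m \<noteq> 0" "\<And>k. of_int m * x ^ k \<in> \<O>"
    using assms(1) by (elim almost_integralE) blast
  have "\<sigma> (of_int m * x ^ k) = of_int m * \<sigma> x ^ k" for k
    by (simp add: aut_mult[OF assms(2)] aut_power[OF assms(2)] aut_of_int[OF assms(2)] K K_power)
  hence "of_int m * \<sigma> x ^ k \<in> \<O>" for k
    using aut_algebraic_int[OF assms(2) m(2)[of k]] by metis
  thus ?thesis
    by (rule almost_integralI[OF aut_closed[OF assms(2) K] m(1)])
qed

text \<open>With \<open>r = a / b\<close> in lowest terms, every power of \<open>b\<close> divides
  the fixed nonzero \<open>m\<close>, so \<open>b = 1\<close>. The exponent
  \<open>nat \<bar>m\<bar>\<close> already gives the contradiction, as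
  \<open>2 ^ n > n\<close>.\<close>

lemma almost_integral_rational:
  assumes "almost_integral r" "r \<in> \<rat>"
  shows "r \<in> \<int>"
proof -
  obtain m :: int where m: "m \<noteq> 0" "\<And>k. of_int m * r ^ k \<in> \<O>"
    using assms(1) by (elim almost_integralE) blast
  obtain a b where ab: "b > 0" "Rings.coprime a b" "r = of_int a / of_int b"
    using assms(2) by (auto elim: Rats_cases')
  have dvd: "b ^ k dvd m" for k
  proof -
    have "of_int m * r ^ k \<in> \<int>"
      using ints_rational[OF m(2)] assms(2) by simp
    then obtain l :: int where "of_int m * r ^ k = of_int l"
      by (auto elim: Ints_cases)
    hence "(of_int (m * a ^ k) :: 'a) = of_int (l * b ^ k)"
      using ab(1) by (simp add: ab(3) power_divide field_simps)
    hence "m * a ^ k = l * b ^ k"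
      by (simp only: of_int_eq_iff)
    hence "b ^ k dvd m * a ^ k" by simp
    moreover have "Rings.coprime (b ^ k) (a ^ k)"
      using ab(2) by (simp add: coprime_commute)
    ultimately show ?thesis
      by (simp add: coprime_dvd_mult_left_iff)
  qed
  have "b = 1"
  proof (rule ccontr)
    assume "b \<noteq> 1"
    hence "b \<ge> 2" using ab(1) by simp
    hence "2 ^ nat \<bar>m\<bar> \<le> b ^ nat \<bar>m\<bar>" by (simp add: power_mono)
    also have "\<dots> \<le> \<bar>m\<bar>"
      using dvd_imp_le_int[OF m(1) dvd[of "nat \<bar>m\<bar>"]] ab(1) by (simp add: power_abs)
    also have "\<bar>m\<bar> < 2 ^ nat \<bar>m\<bar>"
      using of_nat_less_two_power[of "nat \<bar>m\<bar>", where 'a = int] by simp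
    finally show False by simp
  qed
  thus ?thesis using ab(3) by simp
qed

text \<open>Coefficients are sums of products of the roots, so applying \<sigma> to them amounts to
  applying it to the roots. Membership in \<open>K\<close> is proved along with this because
  \<sigma> respects the operations only there.\<close>

lemma aut_coeff_prod_linear:
  assumes "\<sigma> \<in> G" "finite S" "S \<subseteq> K"
  shows "coeff (\<Prod>y\<in>S. [:- y, 1:]) i \<in> K \<and>
    \<sigma> (coeff (\<Prod>y\<in>S. [:- y, 1:]) i) = coeff (\<Prod>y\<in>S. [:- \<sigma> y, 1:]) i"
  using assms(2,3)
proof (induction S arbitrary: i rule: finite_induct)
  case empty
  show ?case by (auto simp: coeff_pCons aut_0[OF assms(1)] aut_1[OF assms(1)] split: nat.split)
next
  case (insert x S)
  let ?q = "\<Prod>y\<in>S. [:- y, 1:]"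
  have x: "x \<in> K" and IH: "\<And>i. coeff ?q i \<in> K"
    "\<And>i. \<sigma> (coeff ?q i) = coeff (\<Prod>y\<in>S. [:- \<sigma> y, 1:]) i"
    using insert by auto
  show ?case
    using x IH unfolding prod.insert[OF insert.hyps] coeff_linear_mult
    by (auto simp: K_diff K_mult K_uminus aut_diff[OF assms(1)] aut_mult[OF assms(1)]
        aut_uminus[OF assms(1)] aut_0[OF assms(1)] split: nat.split)
qed

lemma almost_integral_coeff_prod_linear:
  assumes "finite S" "\<And>y. y \<in> S \<Longrightarrow> almost_integral y"
  shows "almost_integral (coeff (\<Prod>y\<in>S. [:- y, 1:]) i)"
  using assms
proof (induction S arbitrary: i rule: finite_induct)
  case empty
  show ?case by (auto simp: coeff_pCons intro: almost_integral_if_ints split: nat.split)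
next
  case (insert x S)
  have IH: "almost_integral (coeff (\<Prod>y\<in>S. [:- y, 1:]) j)" for j
    using insert by blast
  have "almost_integral (case i of 0 \<Rightarrow> 0 | Suc j \<Rightarrow> coeff (\<Prod>y\<in>S. [:- y, 1:]) j)"
    using IH by (cases i) (simp_all add: almost_integral_if_ints)
  moreover have "almost_integral (- (x * coeff (\<Prod>y\<in>S. [:- y, 1:]) i))"
    using insert.prems IH by (intro almost_integral_uminus almost_integral_mult) auto
  ultimately show ?case
    unfolding prod.insert[OF insert.hyps] coeff_linear_mult
    using almost_integral_add by fastforce
qed

text \<open>The coefficients of the product of \<open>X - y\<close> over the conjugates \<open>y\<close> of \<open>x\<close> are almost integral
  and rational, hence integers.\<close>

lemma almost_integral_imp_ints:
  assumes "almost_integral x"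
  shows "x \<in> \<O>"
proof -
  have x: "x \<in> K" using assms by (simp add: almost_integral_def)
  let ?C = "conjugates x"
  have fin: "finite ?C" using conjugates_finite_card[OF x] by simp
  define q where "q = (\<Prod>y\<in>?C. [:- y, 1:])"
  have "coeff q i \<in> \<int>" for i
  proof (rule almost_integral_rational)
    show "almost_integral (coeff q i)"
      unfolding q_def
    proof (rule almost_integral_coeff_prod_linear[OF fin])
      fix y assume "y \<in> ?C"
      then obtain \<sigma> where "\<sigma> \<in> G" "y = \<sigma> x" by (auto simp: conjugates_def)
      thus "almost_integral y" using almost_integral_aut[OF assms] by simp
    qed
    show "coeff q i \<in> \<rat>"
    proof (rule fixed_imp_rational)
      show "coeff q i \<in> K"
        using aut_coeff_prod_linear[OF aut_id fin conjugates_subset_K[OF x]] by (simp add: q_def)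
      fix \<sigma> assume \<sigma>: "\<sigma> \<in> G"
      have "(\<Prod>y\<in>?C. [:- \<sigma> y, 1:]) = q"
        unfolding q_def
        using prod.reindex_bij_betw[OF conjugates_aut_bij[OF x \<sigma>], of "\<lambda>y. [:- y, 1:]"] .
      thus "\<sigma> (coeff q i) = coeff q i"
        using aut_coeff_prod_linear[OF \<sigma> fin conjugates_subset_K[OF x], of i] by (simp add: q_def)
    qed
  qed
  moreover have "lead_coeff q = 1"
    unfolding q_def lead_coeff_prod by simp
  moreover have "poly q x = 0"
    using fin conjugates_self[of x] by (auto simp: q_def poly_prod prod_zero_iff)
  ultimately have "algebraic_int x"
    by (intro algebraic_int.intros[of q]) auto
  thus ?thesis using x by (simp add: ints_def)
qed

section \<open>Residues modulo a prime number\<close>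

definition idvd where "idvd p x \<longleftrightarrow> (\<exists>y\<in>\<O>. x = of_nat p * y)"

lemma idvd_mult: "idvd p x \<Longrightarrow> a \<in> \<O> \<Longrightarrow> idvd p (a * x)"
  unfolding idvd_def by (metis ints_mult mult.left_commute)

lemma idvd_add: "idvd p x \<Longrightarrow> idvd p y \<Longrightarrow> idvd p (x + y)"
  unfolding idvd_def by (metis ints_add distrib_left)

lemma idvd_of_nat_mult: "x \<in> \<O> \<Longrightarrow> idvd p (of_nat p * x)"
  unfolding idvd_def by blast

lemma not_idvd_one:
  assumes "prime p"
  shows "\<not> idvd p 1"
proof
  assume "idvd p 1"
  then obtain y where y: "y \<in> \<O>" "1 = of_nat p * y" by (auto simp: idvd_def)
  have "p > 1" using assms prime_gt_1_nat by blast
  hence "y = 1 / of_nat p" using y(2) by (simp add: field_simps)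
  hence "y \<in> \<rat>" by simp
  then obtain k :: int where k: "y = of_int k"
    using ints_rational[OF y(1)] by (auto elim: Ints_cases)
  have "(of_int 1 :: 'a) = of_int (int p * k)" using y(2) k by simp
  hence "1 = int p * k" by (simp only: of_int_eq_iff)
  hence "int p dvd 1" by (metis dvd_triv_left)
  thus False using \<open>p > 1\<close> by simp
qed

text \<open>Linear independence of the residues in \<open>\<O> / p\<O>\<close> over the field with
  \<open>p\<close> elements, expressed through integer coefficients.\<close>

definition indep_mod where
  "indep_mod p S \<longleftrightarrow> finite S \<and> S \<subseteq> \<O> \<and>
    (\<forall>c::'a \<Rightarrow> int. idvd p (\<Sum>x\<in>S. of_int (c x) * x) \<longrightarrow> (\<forall>x\<in>S. int p dvd c x))"

text \<open>A \<open>\<rat>\<close>-linear relation with integer coefficients is divisible by every power of \<open>p\<close>.\<close>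

lemma card_indep_mod:
  assumes "prime p" "indep_mod p S"
  shows "card S \<le> card spanning_set"
proof -
  have fin: "finite S" and sub: "S \<subseteq> \<O>" using assms(2) by (auto simp: indep_mod_def)
  have p: "p > 1" using assms(1) prime_gt_1_nat by blast
  have rel: "\<forall>x\<in>S. int p ^ k dvd c x" if "(\<Sum>x\<in>S. of_int (c x) * x) = 0" for c :: "'a \<Rightarrow> int" and k
    using that
  proof (induction k arbitrary: c)
    case 0
    show ?case by simp
  next
    case (Suc k)
    have "idvd p (\<Sum>x\<in>S. of_int (c x) * x)"
      unfolding Suc.prems idvd_def by (intro bexI[of _ 0]) auto
    hence "\<forall>x\<in>S. \<exists>d. c x = int p * d"
      using assms(2) unfolding indep_mod_def dvd_def by blast
    then obtain d where d: "\<forall>x\<in>S. c x = int p * d x" by (rule bchoice[THEN exE])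
    have "0 = (\<Sum>x\<in>S. of_int (c x) * x)" using Suc.prems by simp
    also have "\<dots> = of_nat p * (\<Sum>x\<in>S. of_int (d x) * x)"
      unfolding sum_distrib_left using d by (intro sum.cong) auto
    finally have "(\<Sum>x\<in>S. of_int (d x) * x) = 0" using p by simp
    from Suc.IH[OF this] show ?case using d by simp
  qed
  have "\<not> rat_span.dependent S"
  proof
    assume "rat_span.dependent S"
    then obtain c :: "'a \<Rightarrow> int" and v
      where c: "v \<in> S" "c v \<noteq> 0" "(\<Sum>w\<in>S. of_int (c w) * w) = 0"
      by (rule rat_dependent_imp_int_relation[OF fin])
    let ?k = "nat \<bar>c v\<bar>"
    have "int p ^ ?k dvd c v" using rel[OF c(3)] c(1) by blast
    hence "int p ^ ?k \<le> \<bar>c v\<bar>" using dvd_imp_le_int[OF c(2), of "int p ^ ?k"] by simp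
    moreover have "2 ^ ?k \<le> int p ^ ?k" using p by (intro power_mono) auto
    moreover have "\<bar>c v\<bar> < 2 ^ ?k"
      using of_nat_less_two_power[of ?k, where 'a = int] by simp
    ultimately show False by linarith
  qed
  moreover have "S \<subseteq> rat_span.span spanning_set" using sub ints_K spanning_set(2) by blast
  ultimately show ?thesis
    using rat_span.independent_span_bound[OF spanning_set(1)] by blast
qed

text \<open>Sets independent modulo \<open>p\<close> have at most \<open>card spanning_set\<close>
  elements, so one of greatest size exists, and it generates \<open>\<O> / p\<O>\<close>. Reducing
  its coefficients to the range from 0 to \<open>p - 1\<close> leaves finitely many
  representatives.\<close>

lemma finite_residues:
  assumes "prime p"
  obtains R where "finite R" "R \<subseteq> \<O>" "\<And>x. x \<in> \<O> \<Longrightarrow> \<exists>r\<in>R. idvd p (x - r)"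
proof -
  have p: "p > 1" using assms prime_gt_1_nat by blast
  have "indep_mod p {}" by (simp add: indep_mod_def)
  then obtain S where S: "indep_mod p S" and max: "\<And>T. indep_mod p T \<Longrightarrow> card T \<le> card S"
    using ex_has_greatest_nat[of "indep_mod p" "{}" card "Suc (card spanning_set)"] card_indep_mod[OF assms]
    unfolding less_Suc_eq_le by blast
  have fin: "finite S" and sub: "S \<subseteq> \<O>" using S by (auto simp: indep_mod_def)
  define comb :: "('a \<Rightarrow> int) \<Rightarrow> 'a" where "comb c = (\<Sum>x\<in>S. of_int (c x) * x)" for c
  have comb_ints: "comb c \<in> \<O>" for c
    unfolding comb_def using sub by (intro ints_sum ints_mult) auto
  have gen: "\<exists>e. idvd p (y - comb e)" if y: "y \<in> \<O>" for y
  proof (cases "y \<in> S")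
    case True
    have "comb (\<lambda>x. if x = y then 1 else 0) = (\<Sum>x\<in>S. if x = y then y else 0)"
      unfolding comb_def by (intro sum.cong) auto
    also have "\<dots> = y" using True fin by simp
    finally have "y - comb (\<lambda>x. if x = y then 1 else 0) = of_nat p * 0" by simp
    thus ?thesis unfolding idvd_def using ints_zero by blast
  next
    case False
    have "\<not> indep_mod p (insert y S)"
      using max[of "insert y S"] False fin by auto
    then obtain c :: "'a \<Rightarrow> int" and x
      where c: "idvd p (\<Sum>x\<in>insert y S. of_int (c x) * x)" "x \<in> insert y S" "\<not> int p dvd c x"
      using fin sub y unfolding indep_mod_def by auto
    have c1: "idvd p (of_int (c y) * y + comb c)"
      using c(1) False fin by (simp add: comb_def)
    \<comment> \<open>If \<open>p\<close> divided \<open>c y\<close>, the relation would shrink to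
      one inside \<open>S\<close>, whose coefficients are all divisible by \<open>p\<close>. So
      \<open>c y\<close> can be inverted modulo \<open>p\<close> and the relation solved for
      \<open>y\<close>.\<close>
    have nd: "\<not> int p dvd c y"
    proof
      assume "int p dvd c y"
      then obtain k where k: "c y = int p * k" by blast
      have "idvd p (of_nat p * (of_int (- k) * y))"
        by (intro idvd_of_nat_mult ints_mult ints_of_int y)
      from idvd_add[OF c1 this] have "idvd p (comb c)" by (simp add: k mult.assoc)
      hence "\<forall>x\<in>S. int p dvd c x" using S by (auto simp: indep_mod_def comb_def)
      thus False using c(2,3) \<open>int p dvd c y\<close> by blast
    qed
    then obtain a b where ab: "a * c y + b * int p = 1" by (rule bezout_prime[OF assms])
    have "(of_int (a * c y + b * int p) :: 'a) = of_int 1" using ab by simp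
    hence ab': "of_int a * of_int (c y) + of_int b * of_nat p = (1 :: 'a)" by simp
    have comb_e: "comb (\<lambda>x. - a * c x) = - of_int a * comb c"
      unfolding comb_def sum_distrib_left by (intro sum.cong) auto
    have "y - comb (\<lambda>x. - a * c x)
        = (of_int a * of_int (c y) + of_int b * of_nat p) * y + of_int a * comb c"
      unfolding ab' comb_e by simp
    also have "\<dots> = of_int a * (of_int (c y) * y + comb c) + of_nat p * (of_int b * y)"
      by (simp add: algebra_simps)
    finally have "idvd p (y - comb (\<lambda>x. - a * c x))"
      using c1 y by (auto intro!: idvd_add idvd_mult idvd_of_nat_mult ints_mult)
    thus ?thesis by blast
  qed
  define R where "R = comb ` (S \<rightarrow>\<^sub>E {0..<int p})"
  show ?thesis
  proof (rule that[of R])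
    show "finite R" unfolding R_def using fin by (intro finite_imageI finite_PiE) auto
    show "R \<subseteq> \<O>" unfolding R_def using comb_ints by blast
    fix x assume "x \<in> \<O>"
    then obtain e where e: "idvd p (x - comb e)" using gen by blast
    define e' where "e' = restrict (\<lambda>x. e x mod int p) S"
    have "comb e' \<in> R"
      unfolding R_def e'_def using p by (intro imageI) auto
    moreover have "idvd p (x - comb e')"
    proof -
      have "comb e = (\<Sum>x\<in>S. of_int (e' x) * x + of_nat p * (of_int (e x div int p) * x))"
        unfolding comb_def
      proof (intro sum.cong refl)
        fix x assume "x \<in> S"
        hence "e x = e' x + int p * (e x div int p)" by (simp add: e'_def)
        hence "(of_int (e x) :: 'a) = of_int (e' x + int p * (e x div int p))" by simp
        thus "of_int (e x) * x = of_int (e' x) * x + of_nat p * (of_int (e x div int p) * x)"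
          by (simp add: algebra_simps)
      qed
      also have "\<dots> = comb e' + of_nat p * comb (\<lambda>x. e x div int p)"
        by (simp add: sum.distrib comb_def sum_distrib_left)
      finally have "x - comb e' = (x - comb e) + of_nat p * comb (\<lambda>x. e x div int p)"
        by simp
      thus ?thesis using idvd_add[OF e idvd_of_nat_mult[OF comb_ints]] by metis
    qed
    ultimately show "\<exists>r\<in>R. idvd p (x - r)" by blast
  qed
qed

text \<open>Pigeonhole on the powers of \<open>x\<close> among finitely many residues. Relative to a
  prime ideal over \<open>p\<close> this has two uses: for \<open>x\<close> outside it, a power of
  \<open>x\<close> is an inverse of \<open>x\<close> modulo the ideal; for \<open>x\<close> inside
  it, \<open>1 - x ^ d\<close> lies outside and kills \<open>x ^ i\<close> modulo
  \<open>p\<close>.\<close>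

lemma power_periodic_mod:
  assumes "prime p" "x \<in> \<O>"
  obtains i d where "d > 0" "idvd p (x ^ i * (1 - x ^ d))"
proof -
  obtain R where R: "finite R" "R \<subseteq> \<O>" "\<And>x. x \<in> \<O> \<Longrightarrow> \<exists>r\<in>R. idvd p (x - r)"
    using finite_residues[OF assms(1)] by blast
  have "\<forall>i. \<exists>r. r \<in> R \<and> idvd p (x ^ i - r)"
    using R(3) ints_power[OF assms(2)] by blast
  then obtain r where r: "\<And>i. r i \<in> R" "\<And>i. idvd p (x ^ i - r i)" by metis
  have "\<not> inj r"
    using R(1) r(1) by (meson finite_imageD finite_subset image_subsetI infinite_UNIV_nat)
  then obtain i j where "r i = r j" "i \<noteq> j" by (auto simp: inj_def)
  then obtain i j where ij: "r i = r j" "i < j"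
    by (metis linorder_neqE_nat)
  have "x ^ i * (1 - x ^ (j - i)) = (x ^ i - r i) + of_int (-1) * (x ^ j - r j)"
    using ij by (simp add: algebra_simps power_add[symmetric])
  hence "idvd p (x ^ i * (1 - x ^ (j - i)))"
    using r(2)[of i] idvd_mult[OF r(2)[of j] ints_of_int[of "-1"]] idvd_add by metis
  thus ?thesis using that[of "j - i" i] ij by simp
qed

end

section \<open>Prime ideals are locally principal\<close>

context galois_number_field
begin

section \<open>Ideals and prime ideals in elementary terms\<close>

lemma cring_ints: "cring (ring_of_integers K)"
proof (rule cringI)
  show "abelian_group (ring_of_integers K)"
  proof (rule abelian_groupI)
    fix x assume "x \<in> carrier (ring_of_integers K)"
    thus "\<exists>y\<in>carrier (ring_of_integers K). y \<oplus>\<^bsub>ring_of_integers K\<^esub> x = \<zero>\<^bsub>ring_of_integers K\<^esub>"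
      by (intro bexI[of _ "- x"]) (auto simp: ints_uminus)
  qed (auto simp: ints_add algebra_simps)
  show "Group.comm_monoid (ring_of_integers K)"
    by (rule comm_monoidI) (auto simp: ints_mult algebra_simps)
qed (auto simp: algebra_simps)

definition is_ideal where
  "is_ideal I \<longleftrightarrow> I \<subseteq> \<O> \<and> 0 \<in> I \<and> (\<forall>x\<in>I. \<forall>y\<in>I. x + y \<in> I) \<and> (\<forall>a\<in>\<O>. \<forall>x\<in>I. a * x \<in> I)"

lemma ideal_iff: "ideal I (ring_of_integers K) \<longleftrightarrow> is_ideal I"
proof
  assume "ideal I (ring_of_integers K)"
  then interpret ideal I "ring_of_integers K" .
  show "is_ideal I"
    using a_subset additive_subgroup.zero_closed[OF additive_subgroup_axioms]
      additive_subgroup.a_closed[OF additive_subgroup_axioms] I_l_closed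
    by (auto simp: is_ideal_def)
next
  assume I: "is_ideal I"
  interpret R: cring "ring_of_integers K" by (rule cring_ints)
  have neg: "- x \<in> I" if "x \<in> I" for x
  proof -
    have "of_int (-1) * x \<in> I"
      using I ints_of_int[of "-1"] that unfolding is_ideal_def by blast
    thus ?thesis by simp
  qed
  have inv: "\<ominus>\<^bsub>ring_of_integers K\<^esub> x = - x" if "x \<in> I" for x
    using R.minus_equality[of "- x" x] I neg[OF that] that unfolding is_ideal_def by auto
  show "ideal I (ring_of_integers K)"
  proof (rule idealI)
    show "ring (ring_of_integers K)" by (rule R.ring_axioms)
    show "subgroup I (add_monoid (ring_of_integers K))"
      using I neg inv unfolding is_ideal_def
      by (intro subgroup.intro) (auto simp: a_inv_def)
    show "x \<otimes>\<^bsub>ring_of_integers K\<^esub> a \<in> I" "a \<otimes>\<^bsub>ring_of_integers K\<^esub> x \<in> I"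
      if "a \<in> I" "x \<in> carrier (ring_of_integers K)" for a x
      using I that by (simp_all add: is_ideal_def mult.commute[of a])
  qed
qed

lemma nonzero_primes_iff:
  "P \<in> nonzero_primes K \<longleftrightarrow> is_ideal P \<and> P \<noteq> {0} \<and> 1 \<notin> P \<and>
     (\<forall>a\<in>\<O>. \<forall>b\<in>\<O>. a * b \<in> P \<longrightarrow> a \<in> P \<or> b \<in> P)"
proof -
  have "primeideal P (ring_of_integers K) \<longleftrightarrow> is_ideal P \<and> \<O> \<noteq> P \<and>
     (\<forall>a\<in>\<O>. \<forall>b\<in>\<O>. a * b \<in> P \<longrightarrow> a \<in> P \<or> b \<in> P)"
    using cring_ints by (auto simp: primeideal_def primeideal_axioms_def ideal_iff)
  moreover have "\<O> = P \<longleftrightarrow> 1 \<in> P" if "is_ideal P"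
  proof
    assume "1 \<in> P"
    hence "a * 1 \<in> P" if "a \<in> \<O>" for a
      using that \<open>is_ideal P\<close> unfolding is_ideal_def by blast
    thus "\<O> = P" using \<open>is_ideal P\<close> by (auto simp: is_ideal_def)
  qed (use ints_one in blast)
  ultimately show ?thesis unfolding nonzero_primes_def by blast
qed

lemma K_fraction:
  assumes "x \<in> K - {0}"
  obtains a b where "a \<in> \<O> - {0}" "b \<in> \<O> - {0}" "x = a / b"
proof -
  obtain m :: int where m: "m \<noteq> 0" "of_int m * x \<in> \<O>"
    using K_eq_fraction assms by blast
  show ?thesis
    using that[of "of_int m * x" "of_int m"] m assms by simp
qed

end

section \<open>A nonzero prime ideal and the prime number below it\<close>

locale galois_prime = galois_number_field K for K :: "'a::field_char_0 set" +
  fixes P :: "'a set"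
  assumes prime: "P \<in> nonzero_primes K"
begin

lemma P_ints: "x \<in> P \<Longrightarrow> x \<in> \<O>"
  and P_zero: "0 \<in> P"
  and P_add: "x \<in> P \<Longrightarrow> y \<in> P \<Longrightarrow> x + y \<in> P"
  and P_mult: "a \<in> \<O> \<Longrightarrow> x \<in> P \<Longrightarrow> a * x \<in> P"
  and P_one: "1 \<notin> P"
  and P_prime: "a \<in> \<O> \<Longrightarrow> b \<in> \<O> \<Longrightarrow> a * b \<in> P \<Longrightarrow> a \<in> P \<or> b \<in> P"
  and P_nonzero: "P \<noteq> {0}"
  using prime unfolding nonzero_primes_iff is_ideal_def by blast+

lemma P_uminus: "x \<in> P \<Longrightarrow> - x \<in> P"
  using P_mult[OF ints_of_int[of "-1"], of x] by simp

lemma P_diff: "x \<in> P \<Longrightarrow> y \<in> P \<Longrightarrow> x - y \<in> P"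
  using P_add[OF _ P_uminus, of x y] by simp

lemma P_power: "a \<in> \<O> \<Longrightarrow> a ^ n \<in> P \<Longrightarrow> a \<in> P"
proof (induction n)
  case (Suc n)
  thus ?case using P_prime[of a "a ^ n"] ints_power by auto
qed (simp add: P_one)

text \<open>The elements that become units in the localization at \<open>P\<close>. The localization
  is not formed: an equation in it is stated in \<open>\<O>\<close> after multiplication by an
  element of \<open>S\<close>.\<close>

definition S where "S = \<O> - P"

lemma S_mult: "a \<in> S \<Longrightarrow> b \<in> S \<Longrightarrow> a * b \<in> S"
  unfolding S_def using P_prime ints_mult by blast

lemma S_one: "1 \<in> S"
  unfolding S_def using P_one by simp

lemma S_ints: "a \<in> S \<Longrightarrow> a \<in> \<O>"
  by (simp add: S_def)

lemma S_nonzero: "a \<in> S \<Longrightarrow> a \<noteq> 0"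
  using P_zero by (auto simp: S_def)

lemma idvd_in_P: "of_nat p \<in> P \<Longrightarrow> idvd p x \<Longrightarrow> x \<in> P"
  unfolding idvd_def using P_mult by (metis mult.commute)

lemma exists_prime_factor:
  "n > 0 \<Longrightarrow> of_nat n \<in> P \<Longrightarrow> \<exists>p. Factorial_Ring.prime p \<and> p dvd n \<and> of_nat p \<in> P"
proof (induction n rule: less_induct)
  case (less n)
  have "n \<noteq> 1" using less.prems P_one by auto
  then obtain q where q: "Factorial_Ring.prime q" "q dvd n" using prime_factor_nat by blast
  then obtain m where m: "n = q * m" by blast
  show ?case
  proof (cases "of_nat q \<in> P")
    case False
    hence "of_nat m \<in> P"
      using less.prems m P_prime[of "of_nat q" "of_nat m"] by simp
    moreover have "m < n" "m > 0"
      using m less.prems prime_gt_1_nat[OF q(1)] by auto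
    ultimately show ?thesis using less.IH m by (metis dvd_mult)
  qed (use q in blast)
qed

lemma exists_prime: "\<exists>p. Factorial_Ring.prime p \<and> of_nat p \<in> P"
proof -
  obtain x where x: "x \<in> P" "x \<noteq> 0" using P_nonzero P_zero by blast
  obtain m :: int and y where m: "m \<noteq> 0" "y \<in> \<O>" "of_int m = x * y"
    using ints_multiple_int[OF P_ints[OF x(1)] x(2)] by blast
  have "of_int m \<in> P" using P_mult[OF m(2) x(1)] m(3) by (simp add: mult.commute)
  moreover have "of_nat (nat \<bar>m\<bar>) = (of_int m :: 'a) \<or> of_nat (nat \<bar>m\<bar>) = (- of_int m :: 'a)"
    by (cases "m \<ge> 0") auto
  ultimately have "of_nat (nat \<bar>m\<bar>) \<in> P" using P_uminus by auto
  thus ?thesis using exists_prime_factor[of "nat \<bar>m\<bar>"] m(1) by auto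
qed

text \<open>An integer in \<open>P\<close> that is prime to \<open>p\<close> would put 1 into
  \<open>P\<close> by Bezout.\<close>

lemma of_int_in_P_iff:
  assumes "Factorial_Ring.prime p" "of_nat p \<in> P"
  shows "of_int m \<in> P \<longleftrightarrow> int p dvd m"
proof
  assume m: "of_int m \<in> P"
  show "int p dvd m"
  proof (rule ccontr)
    assume "\<not> int p dvd m"
    then obtain a b where ab: "a * m + b * int p = 1" by (rule bezout_prime[OF assms(1)])
    have "of_int (a * m + b * int p) = (1::'a)" unfolding ab by simp
    moreover have "of_int a * of_int m + of_int b * of_nat p \<in> P"
      using m assms(2) by (intro P_add P_mult) auto
    ultimately show False using P_one by simp
  qed
next
  assume "int p dvd m"
  then obtain k where "m = int p * k" by blast
  thus "of_int m \<in> P" using P_mult[OF ints_of_int[of k] assms(2)] by (simp add: mult.commute)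
qed

lemma lies_over_iff:
  assumes "Factorial_Ring.prime p"
  shows "lies_over P p \<longleftrightarrow> of_nat p \<in> P"
proof
  assume "lies_over P p"
  hence "P \<inter> \<int> = range (\<lambda>k::int. of_nat p * of_int k)" by (simp add: lies_over_def)
  moreover have "of_nat p \<in> range (\<lambda>k::int. of_nat p * (of_int k :: 'a))"
    by (rule range_eqI[of _ _ 1]) simp
  ultimately show "of_nat p \<in> P" by blast
next
  assume p: "of_nat p \<in> P"
  show "lies_over P p"
    unfolding lies_over_def
  proof (intro equalityI subsetI)
    fix x assume "x \<in> P \<inter> \<int>"
    then obtain m where "x = of_int m" "of_int m \<in> P" by (auto elim: Ints_cases)
    moreover from this obtain k where "m = int p * k"
      using of_int_in_P_iff[OF assms p] by blast
    ultimately show "x \<in> range (\<lambda>k::int. of_nat p * of_int k)" by auto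
  next
    fix x :: 'a assume "x \<in> range (\<lambda>k::int. of_nat p * of_int k)"
    then obtain k where k: "x = of_int (int p * k)" by auto
    have "of_int (int p * k) \<in> P" using of_int_in_P_iff[OF assms p, of "int p * k"] by simp
    thus "x \<in> P \<inter> \<int>" using k by simp
  qed
qed

lemma prime_below_eq:
  assumes "Factorial_Ring.prime p" "of_nat p \<in> P"
  shows "prime_below P = p"
  unfolding prime_below_def
proof (rule the_equality)
  show "Factorial_Ring.prime p \<and> lies_over P p" using assms lies_over_iff by blast
  fix q assume q: "Factorial_Ring.prime q \<and> lies_over P q"
  hence "of_int (int q) \<in> P" using lies_over_iff[of q] by simp
  hence "p dvd q" using of_int_in_P_iff[OF assms, of "int q"] by simp
  thus "q = p" using q assms(1) primes_dvd_imp_eq by blast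
qed

lemma prime_below: "Factorial_Ring.prime (prime_below P)" "of_nat (prime_below P) \<in> P"
  using exists_prime prime_below_eq by auto

text \<open>The periodicity relation modulo \<open>p\<close> holds modulo \<open>P\<close>, where
  the power \<open>s ^ i\<close> can be cancelled; this leaves \<open>s ^ d\<close> congruent to 1,
  and \<open>s ^ (d - 1)\<close> is the inverse.\<close>

lemma P_maximal:
  assumes "s \<in> S"
  obtains t where "t \<in> \<O>" "1 - t * s \<in> P"
proof -
  let ?p = "prime_below P"
  have s: "s \<in> \<O>" "s \<notin> P" using assms by (auto simp: S_def)
  obtain i d where d: "d > 0" "idvd ?p (s ^ i * (1 - s ^ d))"
    using power_periodic_mod[OF prime_below(1) s(1)] by blast
  have "s ^ i * (1 - s ^ d) \<in> P" using idvd_in_P[OF prime_below(2) d(2)] .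
  moreover have "s ^ i \<notin> P" using P_power s by blast
  ultimately have "1 - s ^ d \<in> P"
    using P_prime[of "s ^ i" "1 - s ^ d"] s(1) ints_power ints_diff ints_one by blast
  moreover have "s ^ d = s ^ (d - 1) * s" using d(1) by (metis power_minus_mult)
  ultimately show ?thesis using that[of "s ^ (d - 1)"] s(1) ints_power by simp
qed

text \<open>By periodicity \<open>p\<close> divides \<open>x ^ i * (1 - x ^ d)\<close>, and
  \<open>1 - x ^ d\<close> is outside \<open>P\<close> because \<open>x ^ d\<close> is inside, which
  uses \<open>d > 0\<close>.\<close>

lemma P_locally_nilpotent:
  assumes "x \<in> P"
  obtains s k where "s \<in> S" "idvd (prime_below P) (s * x ^ k)"
proof -
  obtain i d where d: "d > 0" "idvd (prime_below P) (x ^ i * (1 - x ^ d))"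
    using power_periodic_mod[OF prime_below(1) P_ints[OF assms]] by blast
  have "x ^ d = x ^ (d - 1) * x" using d(1) by (metis power_minus_mult)
  hence "x ^ d \<in> P" using P_mult[OF _ assms] ints_power[OF P_ints[OF assms]] by simp
  hence "1 - x ^ d \<in> S"
    using P_one P_add[of "1 - x ^ d" "x ^ d"] ints_diff[OF ints_one P_ints] by (auto simp: S_def)
  thus ?thesis using that[of "1 - x ^ d" i] d(2) by (simp add: mult.commute)
qed

text \<open>Killing the elements of \<open>F\<close> one at a time while keeping the image of \<open>b\<close> in the
  localization of \<open>\<O> / p\<O>\<close> at \<open>P\<close> nonzero.\<close>

lemma exists_local_annihilator:
  assumes "finite F" "F \<subseteq> P"
  shows "\<exists>b\<in>\<O>. (\<forall>t\<in>S. \<not> idvd (prime_below P) (t * b)) \<and> (\<forall>x\<in>F. idvd (prime_below P) (b * x))"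
  using assms
proof (induction F rule: finite_induct)
  case empty
  have "\<not> idvd (prime_below P) (t * 1)" if "t \<in> S" for t
    using idvd_in_P[OF prime_below(2)] that by (auto simp: S_def)
  thus ?case using ints_one by blast
next
  case (insert x F)
  let ?p = "prime_below P"
  obtain b where b: "b \<in> \<O>" "\<And>t. t \<in> S \<Longrightarrow> \<not> idvd ?p (t * b)" "\<And>y. y \<in> F \<Longrightarrow> idvd ?p (b * y)"
    using insert by auto
  have x: "x \<in> \<O>" "x \<in> P" using insert P_ints by auto
  obtain s k where s: "s \<in> S" "idvd ?p (s * x ^ k)" using P_locally_nilpotent[OF x(2)] by blast
  \<comment> \<open>Minimality keeps the new element locally nonzero: with one factor
    \<open>x\<close> fewer, no multiplier from \<open>S\<close> reaches a multiple of
    \<open>p\<close>. The value 0 is impossible by the property of \<open>b\<close>, so there is a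
    factor \<open>x\<close> to remove.\<close>
  define l where "l = (LEAST l. \<exists>t\<in>S. idvd ?p (t * (b * x ^ l)))"
  have "idvd ?p (s * (b * x ^ k))"
    using idvd_mult[OF s(2) b(1)] by (simp add: mult_ac)
  hence ex: "\<exists>l. \<exists>t\<in>S. idvd ?p (t * (b * x ^ l))" using s(1) by blast
  from LeastI_ex[OF ex] obtain t where t: "t \<in> S" "idvd ?p (t * (b * x ^ l))"
    unfolding l_def by blast
  have "l \<noteq> 0"
  proof
    assume "l = 0"
    thus False using t b(2)[OF t(1)] by simp
  qed
  then obtain m where m: "l = Suc m" by (cases l) auto
  have least: "\<not> idvd ?p (t' * (b * x ^ m))" if "t' \<in> S" for t'
    using not_less_Least[of m "\<lambda>l. \<exists>t\<in>S. idvd ?p (t * (b * x ^ l))"] that m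
    unfolding l_def by auto
  define b' where "b' = t * (b * x ^ m)"
  have "b' \<in> \<O>" unfolding b'_def by (intro ints_mult ints_power S_ints[OF t(1)] b(1) x(1))
  moreover have "\<not> idvd ?p (t' * b')" if "t' \<in> S" for t'
    using least[OF S_mult[OF that t(1)]] by (simp add: b'_def mult.assoc)
  moreover have "idvd ?p (b' * y)" if "y \<in> insert x F" for y
  proof (cases "y = x")
    case True
    thus ?thesis using t(2) by (simp add: b'_def m mult_ac)
  next
    case False
    hence "idvd ?p (b * y)" using b(3) that by blast
    from idvd_mult[OF this, of "t * x ^ m"] show ?thesis
      using t(1) x(1) by (simp add: b'_def mult_ac ints_mult ints_power S_ints)
  qed
  ultimately show ?case by blast
qed

text \<open>Each element of \<open>P\<close> is congruent modulo \<open>p\<close> to one of finitely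
  many representatives, which lies in \<open>P\<close> too as \<open>p\<close> does. Killing those
  representatives therefore kills all of \<open>P\<close> modulo \<open>p\<close>.\<close>

lemma exists_annihilator:
  obtains b where "b \<in> \<O>" "\<not> idvd (prime_below P) b" "\<And>x. x \<in> P \<Longrightarrow> idvd (prime_below P) (b * x)"
proof -
  let ?p = "prime_below P"
  obtain R where R: "finite R" "R \<subseteq> \<O>" "\<And>x. x \<in> \<O> \<Longrightarrow> \<exists>r\<in>R. idvd ?p (x - r)"
    using finite_residues[OF prime_below(1)] by blast
  obtain b where b: "b \<in> \<O>" "\<And>t. t \<in> S \<Longrightarrow> \<not> idvd ?p (t * b)"
    "\<And>x. x \<in> R \<inter> P \<Longrightarrow> idvd ?p (b * x)"
    using exists_local_annihilator[of "R \<inter> P"] R(1) by auto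
  have "idvd ?p (b * x)" if x: "x \<in> P" for x
  proof -
    obtain r where r: "r \<in> R" "idvd ?p (x - r)" using R(3)[OF P_ints[OF x]] by blast
    have "r \<in> P" using P_diff[OF x idvd_in_P[OF prime_below(2) r(2)]] by simp
    hence "idvd ?p (b * r)" using b(3) r(1) by blast
    from idvd_add[OF this idvd_mult[OF r(2) b(1)]] show ?thesis by (simp add: algebra_simps)
  qed
  thus ?thesis using that[of b] b(1) b(2)[OF S_one] by simp
qed

text \<open>With \<open>\<alpha> = b / p\<close> for an annihilator \<open>b\<close> as above, \<open>\<alpha> P \<subseteq> P\<close> would make \<open>\<alpha>\<close> integral.
  Any \<open>\<pi> \<in> P\<close> with \<open>\<alpha> \<pi> \<notin> P\<close> generates \<open>P\<close> locally.\<close>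

lemma locally_principal:
  obtains u \<pi> where "u \<in> S" "\<pi> \<in> P" "\<And>x. x \<in> P \<Longrightarrow> \<exists>d\<in>\<O>. u * x = \<pi> * d"
proof -
  let ?p = "prime_below P"
  have p: "(of_nat ?p :: 'a) \<noteq> 0" using prime_gt_0_nat[OF prime_below(1)] by simp
  obtain b where b: "b \<in> \<O>" "\<not> idvd ?p b" "\<And>x. x \<in> P \<Longrightarrow> idvd ?p (b * x)"
    using exists_annihilator by blast
  define \<alpha> where "\<alpha> = b / of_nat ?p"
  have \<alpha>K: "\<alpha> \<in> K" unfolding \<alpha>_def using b(1) by (intro K_divide ints_K) auto
  have \<alpha>P: "\<alpha> * x \<in> \<O>" if x: "x \<in> P" for x
  proof -
    obtain y where "y \<in> \<O>" "b * x = of_nat ?p * y" using b(3)[OF x] by (auto simp: idvd_def)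
    thus ?thesis using p by (simp add: \<alpha>_def)
  qed
  have "\<exists>\<pi>\<in>P. \<alpha> * \<pi> \<notin> P"
  proof (rule ccontr)
    assume "\<not> (\<exists>\<pi>\<in>P. \<alpha> * \<pi> \<notin> P)"
    hence stable: "\<And>x. x \<in> P \<Longrightarrow> \<alpha> * x \<in> P" by blast
    \<comment> \<open>\<open>p\<close> is a common denominator for all powers of \<alpha>, because
      it lies in \<open>P\<close> and \<alpha> preserves \<open>P\<close>. Integrality of \<alpha>
      would then make \<open>b\<close> divisible by \<open>p\<close>.\<close>
    have "of_int (int ?p) * \<alpha> ^ k \<in> P" for k
    proof (induction k)
      case (Suc k)
      thus ?case using stable[OF Suc] by (simp add: mult_ac)
    qed (use prime_below(2) in simp)
    hence "almost_integral \<alpha>"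
      using \<alpha>K p P_ints by (intro almost_integralI[of _ "int ?p"]) auto
    hence "\<alpha> \<in> \<O>" by (rule almost_integral_imp_ints)
    moreover have "b = of_nat ?p * \<alpha>" using p by (simp add: \<alpha>_def)
    ultimately show False using b(2) by (auto simp: idvd_def)
  qed
  then obtain \<pi> where \<pi>: "\<pi> \<in> P" "\<alpha> * \<pi> \<notin> P" by blast
  show ?thesis
  \<comment> \<open>The multiplier is \<open>\<alpha> * \<pi>\<close> itself: its product with
    \<open>x\<close> is \<pi> times \<open>\<alpha> * x\<close>, and the latter is integral since
    \<open>b\<close> kills \<open>P\<close> modulo \<open>p\<close>.\<close>
  proof (rule that[of "\<alpha> * \<pi>" \<pi>])
    show "\<alpha> * \<pi> \<in> S" using \<pi> \<alpha>P by (simp add: S_def)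
    fix x assume "x \<in> P"
    thus "\<exists>d\<in>\<O>. \<alpha> * \<pi> * x = \<pi> * d"
      by (intro bexI[of _ "\<alpha> * x"] \<alpha>P) (simp_all add: mult_ac)
  qed (rule \<pi>(1))
qed

end

section \<open>The valuation of a prime ideal\<close>

context galois_prime
begin

text \<open>In the localization at \<open>P\<close> the ideal is generated by \<pi>, with one
  denominator \<open>u\<close> common to all of \<open>P\<close>.\<close>

definition local_gen where
  "local_gen u \<pi> \<longleftrightarrow> u \<in> S \<and> \<pi> \<in> P \<and> (\<forall>x\<in>P. \<exists>d\<in>\<O>. u * x = \<pi> * d)"

lemma exists_local_gen: "\<exists>u \<pi>. local_gen u \<pi>"
  using locally_principal unfolding local_gen_def by metis

abbreviation Ppow where "Ppow k \<equiv> P [^]\<^bsub>ideals_set (ring_of_integers K)\<^esub> (k::nat)"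

lemma Ppow_0: "Ppow 0 = \<O>"
  and Ppow_Suc: "Ppow (Suc k) = ideal_prod (ring_of_integers K) (Ppow k) P"
  by (simp_all add: nat_pow_def ideals_set_def)

lemma one_ideals_set: "\<one>\<^bsub>ideals_set (ring_of_integers K)\<^esub> = \<O>"
  by (simp add: ideals_set_def)

lemma is_ideal_Ppow: "is_ideal (Ppow k)"
proof (induction k)
  case 0
  show ?case unfolding Ppow_0 is_ideal_def by (simp add: ints_add ints_mult)
next
  case (Suc k)
  interpret R: cring "ring_of_integers K" by (rule cring_ints)
  have "ideal P (ring_of_integers K)"
    using prime by (simp add: ideal_iff nonzero_primes_iff)
  thus ?case
    using R.ideal_prod_is_ideal[of "Ppow k" P] Suc unfolding Ppow_Suc by (simp add: ideal_iff)
qed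

lemma Ppow_ints: "a \<in> Ppow k \<Longrightarrow> a \<in> \<O>"
  and Ppow_add: "a \<in> Ppow k \<Longrightarrow> b \<in> Ppow k \<Longrightarrow> a + b \<in> Ppow k"
  and Ppow_mult: "c \<in> \<O> \<Longrightarrow> a \<in> Ppow k \<Longrightarrow> c * a \<in> Ppow k"
  using is_ideal_Ppow[of k] unfolding is_ideal_def by blast+

lemma Ppow_Suc_prod: "a \<in> Ppow k \<Longrightarrow> b \<in> P \<Longrightarrow> a * b \<in> Ppow (Suc k)"
  unfolding Ppow_Suc using ideal_prod.prod[of a "Ppow k" b P "ring_of_integers K"] by simp

lemma Ppow_Suc_subset: "Ppow (Suc k) \<subseteq> Ppow k"
proof -
  interpret R: cring "ring_of_integers K" by (rule cring_ints)
  have "ideal P (ring_of_integers K)"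
    using prime by (simp add: ideal_iff nonzero_primes_iff)
  thus ?thesis
    using R.ideal_prod_inter[of "Ppow k" P] is_ideal_Ppow[of k] unfolding Ppow_Suc
    by (simp add: ideal_iff)
qed

text \<open>Powers of \<open>P\<close> are primary: with \<open>t\<close> inverting \<open>s\<close>
  modulo \<open>P\<close>, write \<open>a = a * (1 - t * s) + t * (s * a)\<close>. The first term
  gains a factor in \<open>P\<close> over the induction hypothesis, the second is in the ideal by
  assumption.\<close>

lemma Ppow_cancel:
  assumes "s \<in> S" "a \<in> \<O>" "s * a \<in> Ppow k"
  shows "a \<in> Ppow k"
  using assms(3)
proof (induction k)
  case 0
  show ?case using assms(2) by (simp add: one_ideals_set)
next
  case (Suc k)
  obtain t where t: "t \<in> \<O>" "1 - t * s \<in> P" using P_maximal[OF assms(1)] .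
  have "a \<in> Ppow k" using Suc Ppow_Suc_subset by blast
  hence "a * (1 - t * s) \<in> Ppow (Suc k)" using t(2) by (rule Ppow_Suc_prod)
  from Ppow_add[OF this Ppow_mult[OF t(1) Suc.prems]] show ?case
    by (simp add: algebra_simps)
qed

context
  fixes u \<pi> assumes gen: "local_gen u \<pi>"
begin

lemma gen_u: "u \<in> S" and gen_\<pi>: "\<pi> \<in> P" and gen_div: "x \<in> P \<Longrightarrow> \<exists>d\<in>\<O>. u * x = \<pi> * d"
  using gen unfolding local_gen_def by blast+

lemma gen_ints: "\<pi> \<in> \<O>"
  using gen_\<pi> by (rule P_ints)

lemma gen_nonzero: "\<pi> \<noteq> 0"
proof
  assume "\<pi> = 0"
  moreover obtain d where "u * of_nat (prime_below P) = \<pi> * d"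
    using gen_div[OF prime_below(2)] by blast
  ultimately show False
    using S_nonzero[OF gen_u] prime_gt_0_nat[OF prime_below(1)] by simp
qed

lemma gen_power_Ppow: "\<pi> ^ k \<in> Ppow k"
proof (induction k)
  case (Suc k)
  show ?case using Ppow_Suc_prod[OF Suc gen_\<pi>] by (simp add: mult.commute)
qed (simp add: one_ideals_set)

text \<open>Locally the power of the ideal is generated by \<open>\<pi> ^ k\<close>. This replaces
  the inductively generated ideal product by divisibility by one element, up to a multiplier from
  \<open>S\<close>.\<close>

lemma Ppow_iff: "a \<in> Ppow k \<longleftrightarrow> a \<in> \<O> \<and> (\<exists>s\<in>S. \<exists>c\<in>\<O>. s * a = \<pi> ^ k * c)"
proof
  assume "a \<in> \<O> \<and> (\<exists>s\<in>S. \<exists>c\<in>\<O>. s * a = \<pi> ^ k * c)"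
  then obtain s c where "a \<in> \<O>" "s \<in> S" "c \<in> \<O>" "s * a = \<pi> ^ k * c" by blast
  moreover from this have "s * a \<in> Ppow k"
    using Ppow_mult[OF _ gen_power_Ppow, of c k] by (simp add: mult.commute)
  ultimately show "a \<in> Ppow k" using Ppow_cancel by blast
next
  assume a: "a \<in> Ppow k"
  have "\<exists>s\<in>S. \<exists>c\<in>\<O>. s * a = \<pi> ^ k * c"
    using a
  proof (induction k arbitrary: a)
    case 0
    thus ?case using S_one by (intro bexI[of _ 1] bexI[of _ a]) (simp_all add: one_ideals_set)
  next
    case (Suc k)
    from Suc.prems show ?case
      unfolding Ppow_Suc
    proof (induction a rule: ideal_prod.induct)
      case (prod i j)
      obtain s c where s: "s \<in> S" "c \<in> \<O>" "s * i = \<pi> ^ k * c" using Suc.IH[OF prod(1)] by blast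
      obtain d where d: "d \<in> \<O>" "u * j = \<pi> * d" using gen_div[OF prod(2)] by blast
      have "(s * u) * (i * j) = (s * i) * (u * j)" by (simp add: mult_ac)
      also have "\<dots> = \<pi> ^ Suc k * (c * d)" unfolding s(3) d(2) by (simp add: mult_ac)
      finally show ?case
        using S_mult[OF s(1) gen_u] ints_mult[OF s(2) d(1)] by (intro bexI) simp_all
    next
      case (sum x y)
      obtain s c where s: "s \<in> S" "c \<in> \<O>" "s * x = \<pi> ^ Suc k * c" using sum.IH(1) by blast
      obtain t d where t: "t \<in> S" "d \<in> \<O>" "t * y = \<pi> ^ Suc k * d" using sum.IH(2) by blast
      have "(s * t) * (x + y) = t * (s * x) + s * (t * y)" by (simp add: algebra_simps)
      also have "\<dots> = \<pi> ^ Suc k * (t * c + s * d)" unfolding s(3) t(3) by (simp add: algebra_simps)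
      finally show ?case
        using S_mult[OF s(1) t(1)] s(1,2) t(1,2)
        by (intro bexI[of _ "s * t"] bexI[of _ "t * c + s * d"])
          (simp_all add: ints_add ints_mult S_ints)
    qed
  qed
  thus "a \<in> \<O> \<and> (\<exists>s\<in>S. \<exists>c\<in>\<O>. s * a = \<pi> ^ k * c)" using Ppow_ints[OF a] by blast
qed

text \<open>For \<open>j > k\<close>, cancelling \<open>\<pi> ^ k\<close> leaves a factor \<pi> in
  the product of two elements of \<open>S\<close>.\<close>

lemma Ppow_le:
  assumes "s \<in> S" "c \<in> S" "s * a = \<pi> ^ k * c" "a \<in> Ppow j"
  shows "j \<le> k"
proof (rule ccontr)
  assume "\<not> j \<le> k"
  then obtain i where i: "j = Suc i + k" by (metis add.commute add_Suc less_natE not_le)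
  obtain t e where t: "t \<in> S" "e \<in> \<O>" "t * a = \<pi> ^ j * e"
    using assms(4) Ppow_iff by blast
  have "\<pi> ^ k * (t * c) = t * (s * a)" unfolding assms(3) by (simp add: mult_ac)
  also have "\<dots> = s * (t * a)" by (simp add: mult_ac)
  also have "\<dots> = \<pi> ^ k * ((s * \<pi> ^ i * e) * \<pi>)" unfolding t(3) i by (simp add: power_add mult_ac)
  finally have "t * c = (s * \<pi> ^ i * e) * \<pi>" using gen_nonzero by simp
  moreover have "\<dots> \<in> P"
    using assms(1) t(2) gen_ints by (intro P_mult[OF _ gen_\<pi>] ints_mult ints_power) (auto simp: S_ints)
  ultimately show False using S_mult[OF t(1) assms(2)] by (simp add: S_def)
qed

text \<open>The equation says that \<open>a\<close> is locally a unit times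
  \<open>\<pi> ^ k\<close>, the form in which valuations are computed from here on. The set under
  the maximum is then \<open>{..k}\<close>, finite and nonempty.\<close>

lemma ord_integral_eq:
  assumes "a \<in> \<O>" "s \<in> S" "c \<in> S" "s * a = \<pi> ^ k * c"
  shows "ord_integral K P a = k"
proof -
  have "a \<in> Ppow j" if "j \<le> k" for j
  proof -
    have "s * a = \<pi> ^ j * (\<pi> ^ (k - j) * c)"
      using that by (simp add: assms(4) mult.assoc[symmetric] power_add[symmetric])
    moreover have "\<pi> ^ (k - j) * c \<in> \<O>"
      using assms(3) gen_ints by (simp add: ints_mult ints_power S_ints)
    ultimately show ?thesis using assms(1,2) Ppow_iff by blast
  qed
  hence "{j. a \<in> Ppow j} = {..k}" using Ppow_le[OF assms(2-4)] by blast
  thus ?thesis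
    unfolding ord_integral_def by (simp add: Max_eq_iff)
qed

text \<open>At the largest \<open>k\<close>, an element \<open>c\<close> of \<open>P\<close> would
  let \<open>u\<close> split off one more factor \<pi>.\<close>

lemma exists_ord_if_bounded:
  assumes "a \<in> \<O>" "\<And>k. a \<in> Ppow k \<Longrightarrow> k \<le> N"
  shows "\<exists>k. \<exists>s\<in>S. \<exists>c\<in>S. s * a = \<pi> ^ k * c"
proof -
  obtain k where k: "a \<in> Ppow k" "\<And>j. a \<in> Ppow j \<Longrightarrow> j \<le> k"
    using Nat.ex_has_greatest_nat[of "\<lambda>k. a \<in> Ppow k" 0 N] assms
    unfolding Ppow_0 by blast
  obtain s c where s: "s \<in> S" "c \<in> \<O>" "s * a = \<pi> ^ k * c" using k(1) Ppow_iff by blast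
  have "c \<notin> P"
  proof
    assume "c \<in> P"
    then obtain d where d: "d \<in> \<O>" "u * c = \<pi> * d" using gen_div by blast
    have "(u * s) * a = \<pi> ^ k * (u * c)" using s(3) by (simp add: mult_ac)
    also have "\<dots> = \<pi> ^ Suc k * d" unfolding d(2) by (simp add: mult_ac)
    finally have "a \<in> Ppow (Suc k)"
      using Ppow_iff assms(1) S_mult[OF gen_u s(1)] d(1) by blast
    thus False using k(2) by fastforce
  qed
  thus ?thesis using s by (auto simp: S_def)
qed

text \<open>The bound on the exponents comes from nilpotence: some \<open>s * \<pi> ^ n\<close> is a
  multiple of \<open>p\<close>, so \<open>k\<close> cannot exceed \<open>n\<close>. Products extend
  this to positive integers, and every nonzero element of \<open>\<O>\<close> inherits a bound from
  an integer that it divides.\<close>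

lemma exists_ord_prime: "\<exists>k. \<exists>s\<in>S. \<exists>c\<in>S. s * of_nat (prime_below P) = \<pi> ^ k * c"
proof -
  let ?p = "of_nat (prime_below P) :: 'a"
  obtain s n y where s: "s \<in> S" "y \<in> \<O>" "s * \<pi> ^ n = ?p * y"
    using P_locally_nilpotent[OF gen_\<pi>] unfolding idvd_def by metis
  show ?thesis
  proof (rule exists_ord_if_bounded)
    show "?p \<in> \<O>" by simp
    fix k assume "?p \<in> Ppow k"
    hence "y * ?p \<in> Ppow k" using Ppow_mult s(2) by blast
    hence "s * \<pi> ^ n \<in> Ppow k" using s(3) by (simp add: mult.commute)
    thus "k \<le> n" using Ppow_le[of 1 s "s * \<pi> ^ n" n k] S_one s(1) by (simp add: mult.commute)
  qed
qed

lemma exists_ord_nat: "n > 0 \<Longrightarrow> \<exists>k. \<exists>s\<in>S. \<exists>c\<in>S. s * of_nat n = \<pi> ^ k * c"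
proof (induction n rule: less_induct)
  case (less n)
  let ?p = "prime_below P"
  show ?case
  proof (cases "of_nat n \<in> P")
    case True
    hence "of_int (int n) \<in> P" by simp
    hence "?p dvd n" using of_int_in_P_iff[OF prime_below, of "int n"] by simp
    then obtain m where m: "n = ?p * m" by blast
    have "m < n" "m > 0" using m less.prems prime_gt_1_nat[OF prime_below(1)] by auto
    then obtain k s c where s: "s \<in> S" "c \<in> S" "s * of_nat m = \<pi> ^ k * c"
      using less.IH by blast
    obtain l t d where t: "t \<in> S" "d \<in> S" "t * of_nat ?p = \<pi> ^ l * d"
      using exists_ord_prime by blast
    have "(s * t) * of_nat n = (s * of_nat m) * (t * of_nat ?p)"
      using m by (metis (no_types, lifting) mult.assoc mult.commute of_nat_mult)
    also have "\<dots> = \<pi> ^ (k + l) * (c * d)" unfolding s(3) t(3) by (simp add: power_add mult_ac)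
    finally show ?thesis using S_mult s(1,2) t(1,2) by blast
  next
    case False
    hence "of_nat n \<in> S" by (simp add: S_def)
    moreover have "1 * of_nat n = \<pi> ^ 0 * of_nat n" by simp
    ultimately show ?thesis using S_one by blast
  qed
qed

lemma exists_ord:
  assumes "a \<in> \<O>" "a \<noteq> 0"
  shows "\<exists>k. \<exists>s\<in>S. \<exists>c\<in>S. s * a = \<pi> ^ k * c"
proof -
  obtain m :: int and y where m: "m \<noteq> 0" "y \<in> \<O>" "of_int m = a * y"
    using ints_multiple_int[OF assms] .
  define n where "n = nat \<bar>m\<bar>"
  have "int n = sgn m * m" unfolding n_def by (simp add: sgn_if)
  hence "of_nat n = of_int (sgn m) * (of_int m :: 'a)" by (metis of_int_mult of_int_of_nat_eq)
  hence n: "of_nat n = (of_int (sgn m) * y) * a" using m(3) by (simp add: mult_ac)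
  obtain k s c where s: "s \<in> S" "c \<in> S" "s * of_nat n = \<pi> ^ k * c"
    using exists_ord_nat[of n] m(1) by (auto simp: n_def)
  show ?thesis
  proof (rule exists_ord_if_bounded[OF assms(1)])
    fix j assume "a \<in> Ppow j"
    hence "of_nat n \<in> Ppow j" unfolding n using Ppow_mult m(2) ints_mult ints_of_int by blast
    thus "j \<le> k" using Ppow_le s by blast
  qed
qed

end

section \<open>Additivity and the valuation on the field\<close>

lemma ord_integral_mult:
  assumes "a \<in> \<O> - {0}" "b \<in> \<O> - {0}"
  shows "ord_integral K P (a * b) = ord_integral K P a + ord_integral K P b"
proof -
  obtain u \<pi> where gen: "local_gen u \<pi>" using exists_local_gen by blast
  obtain k s c where s: "s \<in> S" "c \<in> S" "s * a = \<pi> ^ k * c"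
    using exists_ord[OF gen] assms(1) by blast
  obtain l t d where t: "t \<in> S" "d \<in> S" "t * b = \<pi> ^ l * d"
    using exists_ord[OF gen] assms(2) by blast
  have "(s * t) * (a * b) = (s * a) * (t * b)" by (simp add: mult_ac)
  also have "\<dots> = \<pi> ^ (k + l) * (c * d)" unfolding s(3) t(3) by (simp add: power_add mult_ac)
  finally have "ord_integral K P (a * b) = k + l"
    using assms by (intro ord_integral_eq[OF gen _ S_mult[OF s(1) t(1)] S_mult[OF s(2) t(2)]])
      (auto intro: ints_mult)
  moreover have "ord_integral K P a = k" using ord_integral_eq[OF gen _ s] assms by blast
  moreover have "ord_integral K P b = l" using ord_integral_eq[OF gen _ t] assms by blast
  ultimately show ?thesis by simp
qed

lemma ord_integral_eq_0_iff:
  assumes "a \<in> \<O> - {0}"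
  shows "ord_integral K P a = 0 \<longleftrightarrow> a \<notin> P"
proof -
  obtain u \<pi> where gen: "local_gen u \<pi>" using exists_local_gen by blast
  show ?thesis
  proof
    assume 0: "ord_integral K P a = 0"
    obtain k s c where s: "s \<in> S" "c \<in> S" "s * a = \<pi> ^ k * c"
      using exists_ord[OF gen] assms by blast
    hence "s * a \<in> S" using ord_integral_eq[OF gen _ s] 0 assms by simp
    thus "a \<notin> P" using P_mult[OF S_ints[OF s(1)]] by (auto simp: S_def)
  next
    assume "a \<notin> P"
    hence "a \<in> S" using assms by (simp add: S_def)
    thus "ord_integral K P a = 0"
      using ord_integral_eq[OF gen _ S_one, of a a 0] assms by simp
  qed
qed

text \<open>Two fractions for one element have equal cross products, so additivity on
  \<open>\<O>\<close> makes the value asked for in \<open>ord_at\<close> unique.\<close>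

lemma ord_at_fraction:
  assumes "a \<in> \<O> - {0}" "b \<in> \<O> - {0}"
  shows "ord_at K P (a / b) = int (ord_integral K P a) - int (ord_integral K P b)"
  unfolding ord_at_def
proof (rule the_equality)
  show "\<exists>a'\<in>carrier (ring_of_integers K) - {0}. \<exists>b'\<in>carrier (ring_of_integers K) - {0}.
     a / b = a' / b' \<and> int (ord_integral K P a) - int (ord_integral K P b)
       = int (ord_integral K P a') - int (ord_integral K P b')"
    using assms by auto
next
  fix n
  assume "\<exists>a'\<in>carrier (ring_of_integers K) - {0}. \<exists>b'\<in>carrier (ring_of_integers K) - {0}.
     a / b = a' / b' \<and> n = int (ord_integral K P a') - int (ord_integral K P b')"
  then obtain a' b' where ab: "a' \<in> \<O> - {0}" "b' \<in> \<O> - {0}" "a / b = a' / b'"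
    and n: "n = int (ord_integral K P a') - int (ord_integral K P b')" by auto
  have "a * b' = a' * b" using ab assms by (simp add: field_simps)
  hence "ord_integral K P a + ord_integral K P b' = ord_integral K P a' + ord_integral K P b"
    using ord_integral_mult[OF assms(1) ab(2)] ord_integral_mult[OF ab(1) assms(2)] by simp
  thus "n = int (ord_integral K P a) - int (ord_integral K P b)" using n by linarith
qed

lemma ord_at_ints: "a \<in> \<O> - {0} \<Longrightarrow> ord_at K P a = int (ord_integral K P a)"
  using ord_at_fraction[of a 1] ord_integral_eq_0_iff[of 1] P_one by simp

lemma ord_at_mult:
  assumes "x \<in> K - {0}" "y \<in> K - {0}"
  shows "ord_at K P (x * y) = ord_at K P x + ord_at K P y"
proof -
  obtain a b where ab: "a \<in> \<O> - {0}" "b \<in> \<O> - {0}" "x = a / b" using K_fraction[OF assms(1)] .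
  obtain c d where cd: "c \<in> \<O> - {0}" "d \<in> \<O> - {0}" "y = c / d" using K_fraction[OF assms(2)] .
  have "a * c \<in> \<O> - {0}" "b * d \<in> \<O> - {0}" using ab cd by (auto intro: ints_mult)
  moreover have "x * y = (a * c) / (b * d)" using ab cd by simp
  ultimately show ?thesis
    using ord_at_fraction ord_integral_mult ab cd by simp
qed

lemma ord_at_eq_0:
  assumes "a \<in> \<O> - {0}" "b \<in> \<O> - {0}" "a \<notin> P" "b \<notin> P"
  shows "ord_at K P (a / b) = 0"
  using assms ord_integral_eq_0_iff[of a] ord_integral_eq_0_iff[of b] by (simp add: ord_at_fraction)

text \<open>This is the divisor in \<open>val_at\<close>; were it 0, division by zero would make all
  values 0.\<close>

lemma ord_at_prime_below: "ord_at K P (of_nat (prime_below P)) \<noteq> 0"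
proof -
  have "of_nat (prime_below P) \<in> \<O> - {0}" using prime_gt_0_nat[OF prime_below(1)] by simp
  thus ?thesis using ord_at_ints ord_integral_eq_0_iff prime_below(2) by simp
qed

lemma val_at_mult:
  assumes "x \<in> K - {0}" "y \<in> K - {0}"
  shows "val_at K P (x * y) = val_at K P x + val_at K P y"
  using ord_at_mult[OF assms] by (simp add: val_at_def add_divide_distrib)

lemma val_at_eq_0_iff: "val_at K P x = 0 \<longleftrightarrow> ord_at K P x = 0"
  using ord_at_prime_below by (simp add: val_at_def)

lemma val_at_prime:
  assumes "Factorial_Ring.prime p"
  shows "val_at K P (of_nat p) = (if of_nat p \<in> P then 1 else 0)"
proof -
  have "of_nat p \<in> \<O> - {0}" using prime_gt_0_nat[OF assms] by simp
  hence "of_nat p \<notin> P \<Longrightarrow> ord_at K P (of_nat p) = 0"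
    using ord_at_ints ord_integral_eq_0_iff by simp
  moreover have "of_nat p \<in> P \<Longrightarrow> val_at K P (of_nat p) = 1"
    using prime_below_eq[OF assms] ord_at_prime_below by (auto simp: val_at_def)
  ultimately show ?thesis by (simp add: val_at_eq_0_iff)
qed

end

section \<open>The arithmetic logarithmic derivative\<close>

context galois_number_field
begin

section \<open>The primes over a prime number and the support of an element\<close>

lemma galois_primeI: "P \<in> nonzero_primes K \<Longrightarrow> galois_prime K P"
  using galois_number_field_axioms by (simp add: galois_prime_def galois_prime_axioms_def)

text \<open>An ideal containing \<open>p\<close> is a union of residue classes modulo
  \<open>p\<close>, hence determined by the representatives in \<open>R\<close> that it
  contains.\<close>

lemma finite_ideals_over:
  assumes "prime p"
  shows "finite {I. is_ideal I \<and> of_nat p \<in> I}"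
proof -
  obtain R where R: "finite R" "R \<subseteq> \<O>" "\<And>x. x \<in> \<O> \<Longrightarrow> \<exists>r\<in>R. idvd p (x - r)"
    using finite_residues[OF assms] by blast
  have eq: "I = {x \<in> \<O>. \<exists>r\<in>I \<inter> R. idvd p (x - r)}" if I: "is_ideal I" "of_nat p \<in> I" for I
  proof (intro equalityI subsetI)
    have idvd_I: "x \<in> I" if "idvd p x" for x
      using that I unfolding idvd_def is_ideal_def by (metis mult.commute)
    have add: "x + y \<in> I" if "x \<in> I" "y \<in> I" for x y
      using that I unfolding is_ideal_def by blast
    show "x \<in> {x \<in> \<O>. \<exists>r\<in>I \<inter> R. idvd p (x - r)}" if x: "x \<in> I" for x
    proof -
      have xO: "x \<in> \<O>" using x I unfolding is_ideal_def by blast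
      then obtain r where r: "r \<in> R" "idvd p (x - r)" using R(3) by blast
      have "idvd p (r - x)"
        using idvd_mult[OF r(2) ints_of_int[of "-1"]] by simp
      hence "x + (r - x) \<in> I" using add[OF x] idvd_I by blast
      thus ?thesis using xO r by auto
    qed
    show "x \<in> I" if "x \<in> {x \<in> \<O>. \<exists>r\<in>I \<inter> R. idvd p (x - r)}" for x
    proof -
      obtain r where "r \<in> I" "idvd p (x - r)" using \<open>x \<in> {x \<in> \<O>. \<exists>r\<in>I \<inter> R. idvd p (x - r)}\<close> by blast
      hence "r + (x - r) \<in> I" using add idvd_I by blast
      thus ?thesis by simp
    qed
  qed
  have "inj_on (\<lambda>I. I \<inter> R) {I. is_ideal I \<and> of_nat p \<in> I}"
  proof (rule inj_onI)
    fix I J assume *: "I \<in> {I. is_ideal I \<and> of_nat p \<in> I}" "J \<in> {I. is_ideal I \<and> of_nat p \<in> I}"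
      "I \<inter> R = J \<inter> R"
    show "I = J" using eq[of I] eq[of J] * by auto
  qed
  moreover have "(\<lambda>I. I \<inter> R) ` {I. is_ideal I \<and> of_nat p \<in> I} \<subseteq> Pow R" by blast
  ultimately show ?thesis
    using R(1) by (meson finite_Pow_iff inj_on_finite)
qed

definition primes_over where "primes_over p = {P \<in> nonzero_primes K. of_nat p \<in> P}"

lemma num_primes_over_eq:
  assumes "prime p"
  shows "num_primes_over p K = card (primes_over p)"
proof -
  have "{P \<in> nonzero_primes K. lies_over P p} = primes_over p"
    unfolding primes_over_def using galois_prime.lies_over_iff[OF galois_primeI assms] by blast
  thus ?thesis by (simp add: num_primes_over_def)
qed

lemma finite_primes_over:
  assumes "prime p"
  shows "finite (primes_over p)"
  by (rule finite_subset[OF _ finite_ideals_over[OF assms]])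
    (auto simp: primes_over_def nonzero_primes_iff)

text \<open>Among the finitely many proper ideals containing \<open>p\<close>, one of which is
  \<open>p\<O>\<close>, a maximal one is prime. Existence makes the divisor g(p, K) nonzero.\<close>

lemma primes_over_nonempty:
  assumes "prime p"
  shows "primes_over p \<noteq> {}"
proof -
  let ?A = "{I. is_ideal I \<and> of_nat p \<in> I \<and> 1 \<notin> I}"
  have "finite ?A" by (rule finite_subset[OF _ finite_ideals_over[OF assms]]) auto
  moreover have "{x. idvd p x} \<in> ?A"
  proof -
    have "{x. idvd p x} \<subseteq> \<O>" unfolding idvd_def by (auto intro: ints_mult)
    moreover have "idvd p 0" "idvd p (of_nat p)"
      using idvd_of_nat_mult[of 0 p] idvd_of_nat_mult[of 1 p] by simp_all
    ultimately show ?thesis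
      using not_idvd_one[OF assms] unfolding is_ideal_def by (auto intro: idvd_add idvd_mult)
  qed
  ultimately obtain M where M: "M \<in> ?A" and max: "\<And>I. I \<in> ?A \<Longrightarrow> M \<subseteq> I \<Longrightarrow> M = I"
    using finite_has_maximal[of ?A] by blast
  have MI: "M \<subseteq> \<O>" "0 \<in> M" "\<And>x y. x \<in> M \<Longrightarrow> y \<in> M \<Longrightarrow> x + y \<in> M"
    "\<And>a x. a \<in> \<O> \<Longrightarrow> x \<in> M \<Longrightarrow> a * x \<in> M"
    using M unfolding is_ideal_def by blast+
  have "a \<in> M \<or> b \<in> M" if ab: "a \<in> \<O>" "b \<in> \<O>" "a * b \<in> M" for a b
  proof (rule ccontr)
    assume nab: "\<not> (a \<in> M \<or> b \<in> M)"
    \<comment> \<open>The ideal generated by \<open>M\<close> and \<open>a\<close>. By maximality it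
      contains 1, and multiplying that representation of 1 by \<open>b\<close> puts \<open>b\<close>
      into \<open>M\<close>.\<close>
    define J where "J = {m + x * a | m x. m \<in> M \<and> x \<in> \<O>}"
    have JI: "m + x * a \<in> J" if "m \<in> M" "x \<in> \<O>" for m x
      unfolding J_def using that by blast
    have sub: "M \<subseteq> J" using JI[OF _ ints_zero] by auto
    have "a \<in> J" using JI[OF MI(2) ints_one] by simp
    have "is_ideal J"
      unfolding is_ideal_def
    proof (intro conjI ballI)
      show "J \<subseteq> \<O>" unfolding J_def using MI(1) ab(1) by (auto intro: ints_add ints_mult)
      show "0 \<in> J" using sub MI(2) by blast
    next
      fix y z assume "y \<in> J" "z \<in> J"
      then obtain m x n w where "m \<in> M" "x \<in> \<O>" "y = m + x * a" "n \<in> M" "w \<in> \<O>" "z = n + w * a"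
        unfolding J_def by blast
      thus "y + z \<in> J"
        using JI[OF MI(3)[of m n] ints_add[of x w]] by (simp add: algebra_simps)
    next
      fix c y assume "c \<in> \<O>" "y \<in> J"
      then obtain m x where "m \<in> M" "x \<in> \<O>" "y = m + x * a" unfolding J_def by blast
      thus "c * y \<in> J"
        using JI[OF MI(4)[of c m] ints_mult[of c x]] \<open>c \<in> \<O>\<close> by (simp add: algebra_simps)
    qed
    moreover have "of_nat p \<in> J" using M sub by blast
    moreover have "M \<noteq> J" using nab \<open>a \<in> J\<close> by blast
    ultimately have "1 \<in> J" using max[of J] sub by blast
    then obtain m x where m: "m \<in> M" "x \<in> \<O>" "1 = m + x * a" unfolding J_def by blast
    have "b = b * (m + x * a)" using m(3) by simp
    also have "\<dots> = b * m + x * (a * b)" by (simp add: algebra_simps)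
    also have "\<dots> \<in> M" by (rule MI(3)[OF MI(4)[OF ab(2) m(1)] MI(4)[OF m(2) ab(3)]])
    finally show False using nab by blast
  qed
  moreover have "M \<noteq> {0}" using M prime_gt_0_nat[OF assms] by auto
  ultimately have "M \<in> primes_over p"
    using M unfolding primes_over_def nonzero_primes_iff by blast
  thus ?thesis by blast
qed

text \<open>\<open>a\<close> divides a nonzero integer \<open>m\<close>, so a prime ideal containing
  \<open>a\<close> lies over a prime factor of \<open>m\<close>.\<close>

lemma finite_primes_containing:
  assumes "a \<in> \<O> - {0}"
  shows "finite {P \<in> nonzero_primes K. a \<in> P}"
proof -
  obtain m :: int and y where m: "m \<noteq> 0" "y \<in> \<O>" "of_int m = a * y"
    using ints_multiple_int[of a] assms by blast
  have "{P \<in> nonzero_primes K. a \<in> P} \<subseteq> (\<Union>p\<in>{p. prime p \<and> p dvd nat \<bar>m\<bar>}. primes_over p)"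
  proof
    fix P assume P: "P \<in> {P \<in> nonzero_primes K. a \<in> P}"
    then interpret galois_prime K P using galois_primeI by blast
    obtain p where p: "Factorial_Ring.prime p" "of_nat p \<in> P" using exists_prime by blast
    have "of_int m \<in> P" using P_mult[OF m(2), of a] P m(3) by (simp add: mult.commute)
    hence "int p dvd m" using of_int_in_P_iff[OF p] by blast
    hence "int p dvd int (nat \<bar>m\<bar>)" by simp
    hence "p dvd nat \<bar>m\<bar>" by (simp only: int_dvd_int_iff)
    thus "P \<in> (\<Union>p\<in>{p. Factorial_Ring.prime p \<and> p dvd nat \<bar>m\<bar>}. primes_over p)"
      using p P by (auto simp: primes_over_def)
  qed
  moreover have "finite {p. prime p \<and> p dvd nat \<bar>m\<bar>}"
    by (rule finite_subset[OF _ finite_divisors_nat[of "nat \<bar>m\<bar>"]]) (use m(1) in auto)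
  ultimately show ?thesis
    by (rule finite_subset[OF _ finite_UN_I]) (simp add: finite_primes_over)
qed

text \<open>A sum over an infinite index set is 0 by convention, so \<open>arith_ld\<close> has its
  intended meaning only through this. A prime in the support contains the numerator or the
  denominator.\<close>

lemma finite_support:
  assumes "x \<in> K - {0}"
  shows "finite {P \<in> nonzero_primes K. val_at K P x \<noteq> 0}"
proof -
  obtain a b where ab: "a \<in> \<O> - {0}" "b \<in> \<O> - {0}" "x = a / b" using K_fraction[OF assms] .
  have "{P \<in> nonzero_primes K. val_at K P x \<noteq> 0}
      \<subseteq> {P \<in> nonzero_primes K. a \<in> P} \<union> {P \<in> nonzero_primes K. b \<in> P}"
  proof
    fix P assume P: "P \<in> {P \<in> nonzero_primes K. val_at K P x \<noteq> 0}"
    then interpret galois_prime K P by (simp add: galois_primeI)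
    have "ord_at K P (a / b) \<noteq> 0" using P ab(3) by (simp add: val_at_eq_0_iff)
    thus "P \<in> {P \<in> nonzero_primes K. a \<in> P} \<union> {P \<in> nonzero_primes K. b \<in> P}"
      using ord_at_eq_0[OF ab(1,2)] P by blast
  qed
  thus ?thesis
    by (rule finite_subset) (simp only: finite_Un finite_primes_containing ab(1,2))
qed

section \<open>Homomorphism property and values at prime numbers\<close>

definition wt where
  "wt P = (of_nat (prime_below P) * of_nat (num_primes_over (prime_below P) K) :: rat)"

text \<open>The supports of two elements and of their product differ; a common finite index set lets
  the sums be added termwise.\<close>

lemma arith_ld_superset:
  assumes "finite F" "F \<subseteq> nonzero_primes K" "{P \<in> nonzero_primes K. val_at K P x \<noteq> 0} \<subseteq> F"
  shows "arith_ld K x = (\<Sum>P\<in>F. val_at K P x / wt P)"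
  unfolding arith_ld_def wt_def using assms by (intro sum.mono_neutral_left) auto

lemma arith_ld_mult:
  assumes "x \<in> K - {0}" "y \<in> K - {0}"
  shows "arith_ld K (x * y) = arith_ld K x + arith_ld K y"
proof -
  let ?supp = "\<lambda>x. {P \<in> nonzero_primes K. val_at K P x \<noteq> 0}"
  have mult: "val_at K P (x * y) = val_at K P x + val_at K P y" if "P \<in> nonzero_primes K" for P
    by (rule galois_prime.val_at_mult[OF galois_primeI[OF that] assms])
  define F where "F = ?supp x \<union> ?supp y"
  have F: "finite F" "F \<subseteq> nonzero_primes K" "?supp x \<subseteq> F" "?supp y \<subseteq> F"
    using finite_support assms by (auto simp: F_def)
  moreover have "?supp (x * y) \<subseteq> F" by (auto simp: F_def mult)
  moreover have "(\<Sum>P\<in>F. val_at K P (x * y) / wt P) = (\<Sum>P\<in>F. val_at K P x / wt P + val_at K P y / wt P)"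
    using F(2) by (intro sum.cong refl) (auto simp: mult add_divide_distrib)
  ultimately show ?thesis
    using arith_ld_superset[of F x] arith_ld_superset[of F y] arith_ld_superset[of F "x * y"]
    by (simp add: sum.distrib)
qed

lemma arith_ld_1: "arith_ld K 1 = 0"
  using arith_ld_mult[of 1 1] by simp

lemma arith_ld_inverse:
  assumes "x \<in> K - {0}"
  shows "arith_ld K (inverse x) = - arith_ld K x"
  using arith_ld_mult[OF assms, of "inverse x"] assms by (simp add: K_inverse arith_ld_1)

lemma arith_ld_minus_1: "arith_ld K (- 1) = 0"
  using arith_ld_mult[of "- 1" "- 1"] K_uminus[OF K_one] by (simp add: arith_ld_1)

lemma arith_ld_prod:
  assumes "finite A" "A \<subseteq> K - {0}"
  shows "arith_ld K (\<Prod>A) = (\<Sum>x\<in>A. arith_ld K x)"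
  using assms
proof (induction A rule: finite_induct)
  case (insert x A)
  have "\<Prod>A \<in> K - {0}" using insert by (auto intro: K_prod)
  thus ?case using insert arith_ld_mult[of x "\<Prod>A"] by simp
qed (simp add: arith_ld_1)

text \<open>Each of the g(p, K) primes over \<open>p\<close> contributes the same share, and the
  factor g(p, K) in the weight cancels their number.\<close>

lemma arith_ld_prime:
  assumes "prime p"
  shows "arith_ld K (of_nat p) = 1 / of_nat p"
proof -
  have val: "val_at K P (of_nat p) = (if of_nat p \<in> P then 1 else 0)" if "P \<in> nonzero_primes K" for P
    by (rule galois_prime.val_at_prime[OF galois_primeI[OF that] assms])
  have "arith_ld K (of_nat p) = (\<Sum>P\<in>primes_over p. val_at K P (of_nat p) / wt P)"
    by (rule arith_ld_superset[OF finite_primes_over[OF assms]])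
      (auto simp: primes_over_def val split: if_splits)
  also have "\<dots> = (\<Sum>P\<in>primes_over p. 1 / (of_nat p * of_nat (card (primes_over p))))"
  proof (intro sum.cong refl)
    fix P assume P: "P \<in> primes_over p"
    hence "prime_below P = p"
      using galois_prime.prime_below_eq[OF galois_primeI _ ] assms by (auto simp: primes_over_def)
    thus "val_at K P (of_nat p) / wt P = 1 / (of_nat p * of_nat (card (primes_over p)))"
      using P val[of P] num_primes_over_eq[OF assms] by (simp add: primes_over_def wt_def)
  qed
  also have "\<dots> = 1 / of_nat p"
    using finite_primes_over[OF assms] primes_over_nonempty[OF assms] by (simp add: card_eq_0_iff)
  finally show ?thesis .
qed

section \<open>Action of automorphisms on primes and valuations\<close>

context
  fixes \<sigma> P assumes \<sigma>: "\<sigma> \<in> G" and P: "P \<in> nonzero_primes K"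
begin

lemma aut_image_ints: "\<sigma> ` \<O> = \<O>"
proof -
  obtain \<tau> where \<tau>: "\<tau> \<in> G" "\<And>x. x \<in> K \<Longrightarrow> \<sigma> (\<tau> x) = x" using aut_inverse[OF \<sigma>] by metis
  have "x \<in> \<sigma> ` \<O>" if "x \<in> \<O>" for x
    using \<tau>(2)[OF ints_K[OF that]] aut_algebraic_int[OF \<tau>(1) that] by (metis imageI)
  thus ?thesis using aut_algebraic_int[OF \<sigma>] by blast
qed

lemma aut_mem_image: "I \<subseteq> K \<Longrightarrow> x \<in> K \<Longrightarrow> \<sigma> x \<in> \<sigma> ` I \<longleftrightarrow> x \<in> I"
  using aut_inj[OF \<sigma>] by blast

lemma aut_image_prime: "\<sigma> ` P \<in> nonzero_primes K"
proof -
  interpret galois_prime K P by (rule galois_primeI[OF P])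
  have PK: "P \<subseteq> K" using P_ints ints_K by blast
  have "is_ideal (\<sigma> ` P)"
    unfolding is_ideal_def
  proof (intro conjI ballI)
    show "\<sigma> ` P \<subseteq> \<O>" using P_ints aut_image_ints by blast
    show "0 \<in> \<sigma> ` P" using imageI[OF P_zero, of \<sigma>] aut_0[OF \<sigma>] by simp
  next
    fix x y assume "x \<in> \<sigma> ` P" "y \<in> \<sigma> ` P"
    then obtain a b where "a \<in> P" "b \<in> P" "x = \<sigma> a" "y = \<sigma> b" by blast
    hence "x + y = \<sigma> (a + b)" "a + b \<in> P" using aut_add[OF \<sigma>, of a b] PK P_add[of a b] by (simp_all add: subset_iff)
    thus "x + y \<in> \<sigma> ` P" by blast
  next
    fix x y assume x: "x \<in> \<O>" and "y \<in> \<sigma> ` P"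
    then obtain b where b: "b \<in> P" "y = \<sigma> b" by blast
    obtain a where a: "a \<in> \<O>" "x = \<sigma> a" using x aut_image_ints by blast
    have "x * y = \<sigma> (a * b)" "a * b \<in> P"
      using a b aut_mult[OF \<sigma>, of a b] PK P_mult[of a b] ints_K[of a] by (simp_all add: subset_iff)
    thus "x * y \<in> \<sigma> ` P" by blast
  qed
  moreover have "1 \<notin> \<sigma> ` P"
    using aut_mem_image[OF PK K_one] P_one aut_1[OF \<sigma>] by simp
  moreover have "\<sigma> ` P \<noteq> {0}"
  proof
    assume *: "\<sigma> ` P = {0}"
    have "x = 0" if "x \<in> P" for x
      using aut_eq_0[OF \<sigma>, of x] PK that * by blast
    thus False using P_nonzero P_zero by blast
  qed
  moreover have "x \<in> \<sigma> ` P \<or> y \<in> \<sigma> ` P" if xy: "x \<in> \<O>" "y \<in> \<O>" "x * y \<in> \<sigma> ` P" for x y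
  proof -
    obtain a where a: "a \<in> \<O>" "x = \<sigma> a" using xy(1) aut_image_ints by blast
    obtain b where b: "b \<in> \<O>" "y = \<sigma> b" using xy(2) aut_image_ints by blast
    have "\<sigma> (a * b) \<in> \<sigma> ` P" using xy(3) a b aut_mult[OF \<sigma>, of a b] ints_K by simp
    hence "a * b \<in> P" using aut_mem_image[OF PK] K_mult ints_K a b by blast
    thus ?thesis using P_prime a b by blast
  qed
  ultimately show ?thesis unfolding nonzero_primes_iff by blast
qed

lemma of_nat_in_aut_image: "of_nat p \<in> \<sigma> ` P \<longleftrightarrow> of_nat p \<in> P"
proof -
  interpret galois_prime K P by (rule galois_primeI[OF P])
  have "P \<subseteq> K" using P_ints ints_K by blast
  thus ?thesis using aut_mem_image[of P "of_nat p"] aut_of_nat[OF \<sigma>, of p] by simp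
qed

lemma prime_below_aut_image: "prime_below (\<sigma> ` P) = prime_below P"
proof -
  interpret galois_prime K P by (rule galois_primeI[OF P])
  show ?thesis
    by (rule galois_prime.prime_below_eq[OF galois_primeI[OF aut_image_prime] prime_below(1)])
      (simp add: of_nat_in_aut_image prime_below(2))
qed

text \<open>\<sigma> carries a local generator of \<open>P\<close>, together with its denominator,
  to one of the image ideal, and thus an equation \<open>s * a = \<pi> ^ k * c\<close> to one with
  the same exponent.\<close>

lemma ord_integral_aut_image:
  assumes a: "a \<in> \<O> - {0}"
  shows "ord_integral K (\<sigma> ` P) (\<sigma> a) = ord_integral K P a"
proof -
  interpret P: galois_prime K P by (rule galois_primeI[OF P])
  interpret Q: galois_prime K "\<sigma> ` P" by (rule galois_primeI[OF aut_image_prime])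
  have PK: "P \<subseteq> K" using P.P_ints ints_K by blast
  have S: "\<sigma> x \<in> Q.S" if "x \<in> P.S" for x
    using that aut_mem_image[OF PK, of x] aut_algebraic_int[OF \<sigma>, of x] ints_K[of x]
    by (simp add: P.S_def Q.S_def)
  obtain u \<pi> where gen: "P.local_gen u \<pi>" using P.exists_local_gen by blast
  hence u: "u \<in> P.S" "\<pi> \<in> P" "\<And>x. x \<in> P \<Longrightarrow> \<exists>d\<in>\<O>. u * x = \<pi> * d"
    unfolding P.local_gen_def by blast+
  have mult: "\<sigma> (x * y) = \<sigma> x * \<sigma> y" if "x \<in> \<O>" "y \<in> \<O>" for x y
    using aut_mult[OF \<sigma>] that ints_K by blast
  have "Q.local_gen (\<sigma> u) (\<sigma> \<pi>)"
    unfolding Q.local_gen_def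
  proof (intro conjI ballI)
    show "\<sigma> u \<in> Q.S" using S u(1) by blast
    show "\<sigma> \<pi> \<in> \<sigma> ` P" using u(2) by blast
    fix y assume "y \<in> \<sigma> ` P"
    then obtain x where x: "x \<in> P" "y = \<sigma> x" by blast
    obtain d where d: "d \<in> \<O>" "u * x = \<pi> * d" using u(3)[OF x(1)] by blast
    have "\<sigma> u * y = \<sigma> (u * x)" using mult[of u x] x P.P_ints P.S_ints[OF u(1)] by simp
    also have "\<dots> = \<sigma> \<pi> * \<sigma> d" using mult[of \<pi> d] d P.P_ints[OF u(2)] by simp
    finally show "\<exists>d\<in>\<O>. \<sigma> u * y = \<sigma> \<pi> * d" using aut_algebraic_int[OF \<sigma> d(1)] by blast
  qed
  obtain k s c where s: "s \<in> P.S" "c \<in> P.S" "s * a = \<pi> ^ k * c"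
    using P.exists_ord[OF gen] a by blast
  have "\<sigma> s * \<sigma> a = \<sigma> (s * a)" using mult[of s a] a P.S_ints[OF s(1)] by simp
  also have "\<dots> = \<sigma> \<pi> ^ k * \<sigma> c"
    unfolding s(3) using mult[of "\<pi> ^ k" c] P.S_ints[OF s(2)] P.P_ints[OF u(2)]
      aut_power[OF \<sigma>, of \<pi> k] by (simp add: ints_power ints_K)
  finally have "ord_integral K (\<sigma> ` P) (\<sigma> a) = k"
    using Q.ord_integral_eq[OF \<open>Q.local_gen (\<sigma> u) (\<sigma> \<pi>)\<close> _ S[OF s(1)] S[OF s(2)]]
      aut_algebraic_int[OF \<sigma>] a by blast
  thus ?thesis using P.ord_integral_eq[OF gen _ s] a by simp
qed

lemma ord_at_aut_image:
  assumes "x \<in> K - {0}"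
  shows "ord_at K (\<sigma> ` P) (\<sigma> x) = ord_at K P x"
proof -
  interpret P: galois_prime K P by (rule galois_primeI[OF P])
  interpret Q: galois_prime K "\<sigma> ` P" by (rule galois_primeI[OF aut_image_prime])
  obtain a b where ab: "a \<in> \<O> - {0}" "b \<in> \<O> - {0}" "x = a / b" using K_fraction[OF assms] .
  have "\<sigma> x = \<sigma> a / \<sigma> b" using ab aut_divide[OF \<sigma>] ints_K by blast
  moreover have "\<sigma> a \<in> \<O> - {0}" "\<sigma> b \<in> \<O> - {0}"
    using ab aut_algebraic_int[OF \<sigma>] aut_eq_0[OF \<sigma>] ints_K by blast+
  ultimately show ?thesis
    using ab by (simp only: P.ord_at_fraction Q.ord_at_fraction ord_integral_aut_image)
qed

lemma val_at_aut_image: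
  assumes "x \<in> K - {0}"
  shows "val_at K (\<sigma> ` P) (\<sigma> x) = val_at K P x"
proof -
  interpret P: galois_prime K P by (rule galois_primeI[OF P])
  have "of_nat (prime_below P) \<in> K - {0}"
    using prime_gt_0_nat[OF P.prime_below(1)] by simp
  from ord_at_aut_image[OF this] show ?thesis
    using ord_at_aut_image[OF assms]
    by (simp add: val_at_def prime_below_aut_image aut_of_nat[OF \<sigma>])
qed

end

text \<open>The weight of a prime ideal depends only on the prime number below it, which \<sigma>
  preserves, so the terms match when the sum is reindexed along \<sigma>.\<close>

lemma arith_ld_aut:
  assumes "\<sigma> \<in> G" "x \<in> K - {0}"
  shows "arith_ld K (\<sigma> x) = arith_ld K x"
proof -
  obtain \<tau> where \<tau>: "\<tau> \<in> G" "\<And>x. x \<in> K \<Longrightarrow> \<tau> (\<sigma> x) = x" "\<And>x. x \<in> K \<Longrightarrow> \<sigma> (\<tau> x) = x"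
    using aut_inverse[OF assms(1)] by metis
  have PK: "P \<subseteq> K" if "P \<in> nonzero_primes K" for P
    using that ints_K unfolding nonzero_primes_iff is_ideal_def by blast
  have \<sigma>x: "\<sigma> x \<in> K - {0}" using assms aut_closed aut_eq_0 by blast
  have inv1: "\<tau> ` \<sigma> ` P = P" if "P \<subseteq> K" for P using \<tau>(2) that by (simp add: image_image subset_iff cong: image_cong)
  have inv2: "\<sigma> ` \<tau> ` P = P" if "P \<subseteq> K" for P using \<tau>(3) that by (simp add: image_image subset_iff cong: image_cong)
  show ?thesis
    unfolding arith_ld_def
  proof (rule sum.reindex_bij_witness[of _ "image \<sigma>" "image \<tau>"])
    fix P assume P: "P \<in> {P. P \<in> nonzero_primes K \<and> val_at K P (\<sigma> x) \<noteq> 0}"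
    hence PK': "P \<subseteq> K" using PK by blast
    show "\<sigma> ` \<tau> ` P = P" using inv2[OF PK'] .
    show "\<tau> ` P \<in> {P. P \<in> nonzero_primes K \<and> val_at K P x \<noteq> 0}"
      using P aut_image_prime[OF \<tau>(1), of P] val_at_aut_image[OF \<tau>(1) _ \<sigma>x, of P] \<tau>(2)[of x] assms(2)
      by simp
    show "val_at K (\<tau> ` P) x /
        (of_nat (prime_below (\<tau> ` P)) * of_nat (num_primes_over (prime_below (\<tau> ` P)) K))
      = val_at K P (\<sigma> x) / (of_nat (prime_below P) * of_nat (num_primes_over (prime_below P) K))"
      using P prime_below_aut_image[OF \<tau>(1), of P] val_at_aut_image[OF \<tau>(1) _ \<sigma>x, of P] \<tau>(2)[of x] assms(2)
      by simp
  next
    fix P assume P: "P \<in> {P. P \<in> nonzero_primes K \<and> val_at K P x \<noteq> 0}"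
    hence PK': "P \<subseteq> K" using PK by blast
    show "\<tau> ` \<sigma> ` P = P" using inv1[OF PK'] .
    show "\<sigma> ` P \<in> {P. P \<in> nonzero_primes K \<and> val_at K P (\<sigma> x) \<noteq> 0}"
      using P aut_image_prime[OF assms(1), of P] val_at_aut_image[OF assms(1) _ assms(2), of P] by simp
  qed
qed

lemma arith_ld_prod_conjugates:
  assumes "x \<in> K - {0}"
  shows "arith_ld K (\<Prod>(conjugates x)) = of_nat (card (conjugates x)) * arith_ld K x"
proof -
  have x: "x \<in> K" "x \<noteq> 0" using assms by auto
  have fin: "finite (conjugates x)" using conjugates_finite_card[OF x(1)] by blast
  have "0 \<notin> conjugates x" using prod_conjugates_nonzero[OF x] fin by auto
  hence "conjugates x \<subseteq> K - {0}" using conjugates_subset_K[OF x(1)] by blast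
  with fin have "arith_ld K (\<Prod>(conjugates x)) = (\<Sum>y\<in>conjugates x. arith_ld K y)"
    by (rule arith_ld_prod)
  also have "\<dots> = (\<Sum>y\<in>conjugates x. arith_ld K x)"
  proof (intro sum.cong refl)
    fix y assume "y \<in> conjugates x"
    then obtain \<sigma> where \<sigma>: "\<sigma> \<in> G" "y = \<sigma> x" by (auto simp: conjugates_def)
    show "arith_ld K y = arith_ld K x" unfolding \<sigma>(2) by (rule arith_ld_aut[OF \<sigma>(1) assms])
  qed
  finally show ?thesis by simp
qed

end

section \<open>Subgroups of the rationals\<close>

interpretation rat_group: group rat_group
proof (rule groupI)
  fix x assume "x \<in> carrier rat_group"
  show "\<exists>y\<in>carrier rat_group. y \<otimes>\<^bsub>rat_group\<^esub> x = \<one>\<^bsub>rat_group\<^esub>"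
    by (rule bexI[of _ "- x"]) (auto simp: rat_group_def)
qed (auto simp: rat_group_def)

lemma rat_group_simps [simp]:
  "carrier rat_group = UNIV" "x \<otimes>\<^bsub>rat_group\<^esub> y = x + y" "\<one>\<^bsub>rat_group\<^esub> = 0"
  by (auto simp: rat_group_def)

lemma rat_group_inv [simp]: "inv\<^bsub>rat_group\<^esub> x = - x"
  by (rule rat_group.inv_equality) auto

lemma subgroup_rat_iff:
  "subgroup H rat_group \<longleftrightarrow> 0 \<in> H \<and> (\<forall>x\<in>H. \<forall>y\<in>H. x + y \<in> H) \<and> (\<forall>x\<in>H. - x \<in> H)"
  by (auto simp: subgroup_def)

lemma subgroup_rat_of_int_mult:
  assumes "subgroup H rat_group" "x \<in> H"
  shows "of_int k * x \<in> H"
proof -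
  have nat: "of_nat n * x \<in> H" for n
    using assms by (induction n) (auto simp: subgroup_rat_iff algebra_simps)
  show ?thesis
  proof (cases "k \<ge> 0")
    case True
    thus ?thesis using nat[of "nat k"] by simp
  next
    case False
    hence "- (of_nat (nat (- k)) * x) = of_int k * x" by simp
    thus ?thesis using nat[of "nat (- k)"] assms(1) by (metis subgroup_rat_iff)
  qed
qed

text \<open>Bezout in additive form. It extracts \<open>1 / b\<close> from a reduced fraction once 1
  is in the group, and it merges coprime denominators.\<close>

lemma subgroup_rat_coprime:
  assumes "subgroup H rat_group" "of_int a * x \<in> H" "of_int b * x \<in> H" "Rings.coprime a b"
  shows "x \<in> H"
proof -
  obtain u v where uv: "u * a + v * b = 1"
    using assms(4) bezout_int[of a b] by (auto simp: coprime_iff_gcd_eq_1)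
  have "x = of_int (u * a + v * b) * x" unfolding uv by simp
  also have "\<dots> = of_int u * (of_int a * x) + of_int v * (of_int b * x)"
    by (simp add: algebra_simps)
  also have "\<dots> \<in> H"
    using subgroup_rat_of_int_mult[OF assms(1,2), of u] subgroup_rat_of_int_mult[OF assms(1,3), of v]
      assms(1) unfolding subgroup_rat_iff by blast
  finally show ?thesis .
qed

section \<open>The group generated by the reciprocals of the primes\<close>

definition prime_recips :: "rat set" where
  "prime_recips = {1 / of_nat p | p::nat. prime p}"

definition recip_group :: "rat set" where
  "recip_group = generate rat_group prime_recips"

lemma subgroup_recip_group: "subgroup recip_group rat_group"
  unfolding recip_group_def by (rule rat_group.generate_is_subgroup) simp

lemma recip_in_recip_group: "prime p \<Longrightarrow> 1 / of_nat p \<in> recip_group"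
  unfolding recip_group_def prime_recips_def by (intro generate.incl) blast

lemma recip_group_subset:
  assumes "subgroup H rat_group" "\<And>p. prime p \<Longrightarrow> 1 / of_nat p \<in> H"
  shows "recip_group \<subseteq> H"
  unfolding recip_group_def using assms
  by (intro rat_group.generate_subgroup_incl) (auto simp: prime_recips_def)

lemma of_int_in_recip_group: "of_int k \<in> recip_group"
proof -
  have "of_int (k * 2) * (1 / of_nat 2) \<in> recip_group"
    by (intro subgroup_rat_of_int_mult subgroup_recip_group recip_in_recip_group two_is_prime_nat)
  thus ?thesis by simp
qed

text \<open>A prime factor \<open>p\<close> of \<open>b\<close> is coprime to the cofactor
  \<open>m\<close>, so \<open>1 / b\<close> is an integer combination of \<open>1 / p\<close> and
  \<open>1 / m\<close>.\<close>

lemma squarefree_recip_in_recip_group: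
  "squarefree b \<Longrightarrow> b > 0 \<Longrightarrow> 1 / of_nat b \<in> recip_group"
proof (induction b rule: less_induct)
  case (less b)
  show ?case
  proof (cases "b = 1")
    case True
    thus ?thesis using of_int_in_recip_group[of 1] by simp
  next
    case False
    then obtain p where p: "prime p" "p dvd b" using prime_factor_nat by blast
    then obtain m where m: "b = p * m" by blast
    have "\<not> p dvd m"
    proof
      assume "p dvd m"
      hence "p ^ 2 dvd b" unfolding m power2_eq_square by (intro mult_dvd_mono dvd_refl)
      thus False using less.prems(1) p(1) by (metis squarefreeD not_prime_unit)
    qed
    hence cop: "Rings.coprime (int p) (int m)" using prime_imp_coprime[OF p(1)] by simp
    have pos: "p > 1" "m > 0" using prime_gt_1_nat[OF p(1)] m less.prems(2) by auto
    have "squarefree m" using less.prems(1) m by (metis squarefree_mono dvd_triv_right)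
    hence "1 / of_nat m \<in> recip_group" using less.IH[of m] m pos by simp
    hence "of_int (int p) * (1 / of_nat b) \<in> recip_group" using m pos by simp
    moreover have "of_int (int m) * (1 / of_nat b) \<in> recip_group"
      using recip_in_recip_group[OF p(1)] m pos by simp
    ultimately show ?thesis
      using subgroup_rat_coprime[OF subgroup_recip_group] cop by blast
  qed
qed

lemma square_recip_notin_recip_group:
  assumes "prime p"
  shows "1 / of_nat (p ^ 2) \<notin> recip_group"
proof
  assume in_grp: "1 / of_nat (p ^ 2) \<in> recip_group"
  have p: "p > 1" using prime_gt_1_nat[OF assms] .
  \<comment> \<open>The rationals of \<open>p\<close>-adic valuation at least -1: a subgroup that
    contains the reciprocal of every prime but not \<open>1 / p ^ 2\<close>.\<close>
  define B :: "rat set" where "B = {of_int a / of_int (int p * b) | a b. \<not> int p dvd b}"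
  have BI: "x \<in> B" if "x * of_int (int p * b) = of_int a" "\<not> int p dvd b" for x a b
  proof -
    have "b \<noteq> 0" using that(2) by auto
    hence "(of_int (int p * b) :: rat) \<noteq> 0" using p by simp
    hence "x = of_int a / of_int (int p * b)" unfolding that(1)[symmetric] by (rule nonzero_mult_div_cancel_right[symmetric])
    thus ?thesis unfolding B_def using that(2) by blast
  qed
  have BE: "\<exists>a b. x * of_int (int p * b) = of_int a \<and> \<not> int p dvd b" if xB: "x \<in> B" for x
  proof -
    obtain a b where ab: "x = of_int a / of_int (int p * b)" "\<not> int p dvd b"
      using xB unfolding B_def by blast
    have "b \<noteq> 0" using ab(2) by auto
    hence "(of_int (int p * b) :: rat) \<noteq> 0" using p by simp
    hence "x * of_int (int p * b) = of_int a" unfolding ab(1) by (simp del: of_int_mult)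
    thus ?thesis using ab(2) by blast
  qed
  have "recip_group \<subseteq> B"
  proof (rule recip_group_subset)
    show "subgroup B rat_group"
      unfolding subgroup_rat_iff
    proof (intro conjI ballI)
      show "0 \<in> B" by (rule BI[of _ 1 0]) (use p in auto)
    next
      fix x y assume "x \<in> B" "y \<in> B"
      from BE[OF this(1)] BE[OF this(2)] obtain a b c d
        where x: "x * of_int (int p * b) = of_int a" "\<not> int p dvd b"
        and y: "y * of_int (int p * d) = of_int c" "\<not> int p dvd d" by blast
      have "(x + y) * of_int (int p * (b * d))
          = (x * of_int (int p * b)) * of_int d + (y * of_int (int p * d)) * of_int b"
        by (simp only: of_int_mult distrib_right distrib_left mult_ac)
      also have "\<dots> = of_int (a * d + c * b)" unfolding x(1) y(1) by simp
      finally have "(x + y) * of_int (int p * (b * d)) = of_int (a * d + c * b)" .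
      moreover have "\<not> int p dvd b * d"
        using x(2) y(2) assms prime_dvd_mult_iff[of "int p" b d] by simp
      ultimately show "x + y \<in> B" by (rule BI)
    next
      fix x assume "x \<in> B"
      from BE[OF this] obtain a b where x: "x * of_int (int p * b) = of_int a" "\<not> int p dvd b"
        by blast
      have "(- x) * of_int (int p * b) = of_int (- a)" unfolding of_int_minus x(1)[symmetric] by simp
      thus "- x \<in> B" using x(2) by (rule BI)
    qed
  next
    fix q :: nat assume q: "prime q"
    show "1 / of_nat q \<in> B"
    proof (cases "q = p")
      case True
      show ?thesis by (rule BI[of _ 1 1]) (use True p in auto)
    next
      case False
      hence "\<not> p dvd q" using primes_dvd_imp_eq[OF assms q] by blast
      thus ?thesis by (intro BI[of _ "int q" "int p"]) (use prime_gt_0_nat[OF q] in auto)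
    qed
  qed
  hence "1 / of_nat (p ^ 2) \<in> B" using in_grp by blast
  from BE[OF this] obtain a b
    where ab: "1 / of_nat (p ^ 2) * of_int (int p * b) = (of_int a :: rat)" "\<not> int p dvd b"
    by blast
  have "(of_int (int p * b) :: rat) = (1 / of_nat (p ^ 2) * of_int (int p * b)) * of_nat (p ^ 2)"
    using p by simp
  also have "\<dots> = of_int (a * (int p)\<^sup>2)"
    unfolding ab(1) by simp
  finally have "int p * b = a * (int p)\<^sup>2" by (simp only: of_int_eq_iff)
  hence "b = int p * a" using p by (simp add: power2_eq_square)
  thus False using ab(2) by simp
qed

text \<open>If \<open>H\<close> is larger than the group \<open>A\<close> generated by the reciprocals of the primes, it contains some
  \<open>1 / p\<^sup>2\<close>, hence \<open>(1 / p) A\<close>; then \<open>p\<close> divides \<open>n\<close> and one passes from \<open>H\<close> to \<open>p H\<close>.\<close>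

lemma bounded_supergroup_eq_scaled:
  assumes "n > 0" "subgroup H rat_group" "recip_group \<subseteq> H"
    "\<And>h. h \<in> H \<Longrightarrow> of_nat n * h \<in> recip_group"
  shows "\<exists>m::nat. m > 0 \<and> (\<lambda>h. of_nat m * h) ` H = recip_group"
  using assms
proof (induction n arbitrary: H rule: less_induct)
  case (less n)
  show ?case
  proof (cases "H = recip_group")
    case True
    thus ?thesis by (intro exI[of _ 1]) simp
  next
    case False
    then obtain h where h: "h \<in> H" "h \<notin> recip_group" using less.prems(3) by blast
    obtain a b where ab: "b > 0" "Rings.coprime a b" "h = of_int a / of_int b"
      using quotient_of_div quotient_of_denom_pos quotient_of_coprime
      by (cases "quotient_of h") blast
    have "of_int a * (1 / of_int b) \<in> H" using h(1) ab(3) by simp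
    moreover have "of_int b * (1 / of_int b) \<in> H"
      using of_int_in_recip_group[of 1] less.prems(3) ab(1) by auto
    ultimately have recip: "1 / of_int b \<in> H"
      using subgroup_rat_coprime[OF less.prems(2)] ab(2) by blast
    have "\<not> squarefree (nat b)"
    proof
      assume "squarefree (nat b)"
      hence "1 / of_nat (nat b) \<in> recip_group"
        using squarefree_recip_in_recip_group[of "nat b"] ab(1) by simp
      from subgroup_rat_of_int_mult[OF subgroup_recip_group this, of a]
      show False using h(2) ab by simp
    qed
    then obtain q where q: "q\<^sup>2 dvd nat b" "\<not> q dvd 1" unfolding squarefree_def by blast
    then obtain p where p: "prime p" "p dvd q" using prime_factor_nat[of q] by auto
    have "p\<^sup>2 dvd nat b" using p(2) q(1) by (meson dvd_power_same dvd_trans)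
    then obtain c where c: "nat b = p\<^sup>2 * c" by blast
    have p1: "p > 1" using prime_gt_1_nat[OF p(1)] .
    have c0: "c > 0" using c ab(1) by (intro Nat.gr0I) auto
    have "(of_int b :: rat) = of_nat (nat b)" using ab(1) by simp
    hence "1 / of_nat (p\<^sup>2) = of_int (int c) * (1 / of_int b :: rat)"
      unfolding c using c0 p1 by (simp add: field_simps)
    hence sq: "1 / of_nat (p\<^sup>2) \<in> H"
      using subgroup_rat_of_int_mult[OF less.prems(2) recip] by metis
    \<comment> \<open>Both \<open>n\<close> and \<open>p\<close> multiply \<open>1 / p ^ 2\<close>
      into \<open>recip_group\<close>; if they were coprime, \<open>1 / p ^ 2\<close> itself would
      lie there.\<close>
    have "p dvd n"
    proof (rule ccontr)
      assume "\<not> p dvd n"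
      hence "Rings.coprime (int n) (int p)"
        using prime_imp_coprime[OF p(1)] by (simp add: coprime_commute)
      moreover have "of_int (int n) * (1 / of_nat (p\<^sup>2)) \<in> recip_group"
        using less.prems(4)[OF sq] by simp
      moreover have "of_int (int p) * (1 / of_nat (p\<^sup>2)) \<in> recip_group"
        using recip_in_recip_group[OF p(1)] p1 by (simp add: power2_eq_square)
      ultimately have "1 / of_nat (p\<^sup>2) \<in> recip_group"
        using subgroup_rat_coprime[OF subgroup_recip_group] by blast
      thus False using square_recip_notin_recip_group[OF p(1)] by blast
    qed
    then obtain k where k: "n = p * k" by blast
    define H' where "H' = (\<lambda>h. of_nat p * h) ` H"
    have "k < n" "k > 0" using k less.prems(1) p1 by auto
    moreover have "subgroup H' rat_group"
      unfolding subgroup_rat_iff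
    proof (intro conjI ballI)
      have "of_nat p * 0 \<in> H'" unfolding H'_def using less.prems(2) by (intro imageI) (simp add: subgroup_rat_iff)
      thus "0 \<in> H'" by simp
    next
      fix x y assume "x \<in> H'" "y \<in> H'"
      then obtain u v where "u \<in> H" "v \<in> H" "x = of_nat p * u" "y = of_nat p * v" unfolding H'_def by blast
      hence "x + y = of_nat p * (u + v)" "u + v \<in> H"
        using less.prems(2) by (auto simp: subgroup_rat_iff algebra_simps)
      thus "x + y \<in> H'" unfolding H'_def by blast
    next
      fix x assume "x \<in> H'"
      then obtain u where "u \<in> H" "x = of_nat p * u" unfolding H'_def by blast
      hence "- x = of_nat p * (- u)" "- u \<in> H" using less.prems(2) by (auto simp: subgroup_rat_iff)
      thus "- x \<in> H'" unfolding H'_def by blast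
    qed
    moreover have "recip_group \<subseteq> H'"
    proof (rule recip_group_subset[OF \<open>subgroup H' rat_group\<close>])
      fix r :: nat assume r: "prime r"
      \<comment> \<open>Multiplied by \<open>p\<close>, this puts \<open>1 / r\<close> into
        \<open>H'\<close>. For \<open>r \<noteq> p\<close> the denominator is squarefree; for
        \<open>r = p\<close> the element found above is used.\<close>
      have "1 / of_nat (p * r) \<in> H"
      proof (cases "r = p")
        case True
        thus ?thesis using sq by (simp add: power2_eq_square)
      next
        case False
        hence "coprime p r" using primes_coprime[OF p(1) r] by blast
        hence "squarefree (p * r)" using p(1) r by (simp add: squarefree_mult_coprime squarefree_prime)
        hence "1 / of_nat (p * r) \<in> recip_group"
          using squarefree_recip_in_recip_group[of "p * r"] p1 prime_gt_0_nat[OF r] by simp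
        thus ?thesis using less.prems(3) by blast
      qed
      hence "of_nat p * (1 / of_nat (p * r)) \<in> H'" unfolding H'_def by (rule imageI)
      thus "1 / of_nat r \<in> H'" using p1 by simp
    qed
    moreover have "of_nat k * h \<in> recip_group" if "h \<in> H'" for h
      using that less.prems(4) unfolding H'_def k by (auto simp: mult_ac)
    ultimately obtain m :: nat where m: "m > 0" "(\<lambda>h. of_nat m * h) ` H' = recip_group"
      using less.IH[of k H'] by blast
    hence "(\<lambda>h. of_nat (m * p) * h) ` H = recip_group"
      unfolding H'_def by (simp add: image_image mult.assoc)
    thus ?thesis using m(1) p1 by (intro exI[of _ "m * p"]) auto
  qed
qed

lemma scaled_subgroup_iso:
  assumes "subgroup H rat_group" "m > 0" "(\<lambda>h. of_nat m * h) ` H = recip_group"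
  shows "rat_group\<lparr>carrier := H\<rparr> \<cong> subgroup_generated rat_group prime_recips"
proof -
  have carrier: "carrier (subgroup_generated rat_group prime_recips) = recip_group"
    by (simp add: subgroup_generated_def recip_group_def)
  have "(\<lambda>h. of_nat m * h) \<in> iso (rat_group\<lparr>carrier := H\<rparr>) (subgroup_generated rat_group prime_recips)"
  proof (rule isoI)
    show "(\<lambda>h. of_nat m * h) \<in> hom (rat_group\<lparr>carrier := H\<rparr>) (subgroup_generated rat_group prime_recips)"
      by (rule homI) (use assms(3) in \<open>auto simp: carrier subgroup_generated_def rat_group_def algebra_simps recip_group_def\<close>)
    show "bij_betw (\<lambda>h. of_nat m * h) (carrier (rat_group\<lparr>carrier := H\<rparr>))
        (carrier (subgroup_generated rat_group prime_recips))"
      using assms(2,3) by (simp add: carrier bij_betw_def inj_on_def)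
  qed
  thus ?thesis by (auto simp: is_iso_def)
qed

section \<open>The image of the logarithmic derivative\<close>

context galois_number_field
begin

lemma arith_ld_of_nat: "n > 0 \<Longrightarrow> arith_ld K (of_nat n) \<in> recip_group"
proof (induction n rule: less_induct)
  case (less n)
  show ?case
  proof (cases "n = 1")
    case True
    thus ?thesis using of_int_in_recip_group[of 0] by (simp add: arith_ld_1)
  next
    case False
    then obtain p where p: "prime p" "p dvd n" using prime_factor_nat by blast
    then obtain m where m: "n = p * m" by blast
    have pos: "p > 1" "m > 0" using prime_gt_1_nat[OF p(1)] m less.prems by auto
    have "arith_ld K (of_nat p * of_nat m) = 1 / of_nat p + arith_ld K (of_nat m)"
      using arith_ld_mult[of "of_nat p" "of_nat m"] arith_ld_prime[OF p(1)] pos by simp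
    moreover have "arith_ld K (of_nat m) \<in> recip_group" using less.IH[of m] m pos by simp
    ultimately show ?thesis
      using recip_in_recip_group[OF p(1)] subgroup_recip_group m by (simp add: subgroup_rat_iff)
  qed
qed

lemma arith_ld_rational:
  assumes "x \<in> \<rat>" "x \<noteq> 0"
  shows "arith_ld K x \<in> recip_group"
proof -
  have A: "x + - y \<in> recip_group" if "x \<in> recip_group" "y \<in> recip_group" for x y
    using subgroup_recip_group that unfolding subgroup_rat_iff by blast
  have int: "arith_ld K (of_int m) \<in> recip_group" if "m \<noteq> 0" for m
  proof (cases "m > 0")
    case True
    thus ?thesis using arith_ld_of_nat[of "nat m"] by simp
  next
    case False
    define n where "n = nat (- m)"
    have n: "n > 0" "m = - int n" using False that by (auto simp: n_def)
    have "arith_ld K ((- 1) * of_nat n) = arith_ld K (of_nat n)"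
      using arith_ld_mult[of "- 1" "of_nat n"] K_uminus[OF K_one] n(1)
      by (simp add: arith_ld_minus_1)
    thus ?thesis using arith_ld_of_nat[OF n(1)] n(2) by simp
  qed
  obtain a b where ab: "b > 0" "x = of_int a / of_int b"
    using assms(1) by (auto elim: Rats_cases')
  hence a: "a \<noteq> 0" using assms(2) by auto
  have "arith_ld K x = arith_ld K (of_int a) + - arith_ld K (of_int b)"
    using arith_ld_mult[of "of_int a" "inverse (of_int b)"] arith_ld_inverse[of "of_int b"] ab a
    by (simp add: K_inverse divide_inverse)
  thus ?thesis using A int[OF a] int[of b] ab(1) by (metis less_irrefl)
qed

lemma subgroup_arith_ld_image: "subgroup (arith_ld K ` (K - {0})) rat_group"
  unfolding subgroup_rat_iff
proof (intro conjI ballI)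
  show "0 \<in> arith_ld K ` (K - {0})" using arith_ld_1 by (intro image_eqI[of _ _ 1]) auto
next
  fix a b assume "a \<in> arith_ld K ` (K - {0})" "b \<in> arith_ld K ` (K - {0})"
  then obtain x y where "x \<in> K - {0}" "y \<in> K - {0}" "a = arith_ld K x" "b = arith_ld K y" by blast
  thus "a + b \<in> arith_ld K ` (K - {0})"
    by (intro image_eqI[of _ _ "x * y"]) (auto simp: arith_ld_mult K_mult)
next
  fix a assume "a \<in> arith_ld K ` (K - {0})"
  then obtain x where "x \<in> K - {0}" "a = arith_ld K x" by blast
  thus "- a \<in> arith_ld K ` (K - {0})"
    by (intro image_eqI[of _ _ "inverse x"]) (auto simp: arith_ld_inverse K_inverse)
qed

lemma recip_group_subset_arith_ld_image: "recip_group \<subseteq> arith_ld K ` (K - {0})"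
proof (rule recip_group_subset[OF subgroup_arith_ld_image])
  fix p :: nat assume p: "prime p"
  thus "1 / of_nat p \<in> arith_ld K ` (K - {0})"
    using arith_ld_prime[OF p] prime_gt_0_nat[OF p] by (intro image_eqI[of _ _ "of_nat p"]) auto
qed

text \<open>The number of conjugates varies with \<open>x\<close>; the factorial is a common
  multiple of all possible numbers, so one multiplier serves the whole image.\<close>

lemma fact_mult_arith_ld:
  assumes "x \<in> K - {0}"
  shows "of_nat (fact (card spanning_set)) * arith_ld K x \<in> recip_group"
proof -
  have x: "x \<in> K" "x \<noteq> 0" using assms by auto
  let ?c = "card (conjugates x)"
  have fin: "finite (conjugates x)" "?c \<le> card spanning_set" using conjugates_finite_card[OF x(1)] by auto
  have "?c > 0" using fin(1) conjugates_self[of x] by (auto simp: card_gt_0_iff)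
  hence "?c dvd fact (card spanning_set)" using fin(2) by (intro dvd_fact) auto
  then obtain k where k: "fact (card spanning_set) = ?c * k" by blast
  have "of_nat ?c * arith_ld K x \<in> recip_group"
    using arith_ld_rational[OF prod_conjugates_rational[OF x(1)] prod_conjugates_nonzero[OF x]]
      arith_ld_prod_conjugates[OF assms] by simp
  from subgroup_rat_of_int_mult[OF subgroup_recip_group this, of "int k"]
  show ?thesis unfolding k by (simp add: mult_ac)
qed

end

theorem theorem4p2:
  fixes K :: "'a::field_char_0 set"
  assumes "finite_Galois_over_Q K"
  shows "subgroup (arith_ld K ` (K - {0})) rat_group \<and>
    rat_group\<lparr>carrier := arith_ld K ` (K - {0})\<rparr> \<cong>
      subgroup_generated rat_group {1 / of_nat p | p::nat. prime p}"
proof -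
  interpret galois_number_field K using assms by unfold_locales
  let ?H = "arith_ld K ` (K - {0})"
  have "of_nat (fact (card spanning_set)) * h \<in> recip_group" if "h \<in> ?H" for h
    using that fact_mult_arith_ld by blast
  then obtain m :: nat where m: "m > 0" "(\<lambda>h. of_nat m * h) ` ?H = recip_group"
    using bounded_supergroup_eq_scaled[OF fact_gt_zero subgroup_arith_ld_image
        recip_group_subset_arith_ld_image] by blast
  show ?thesis
    using subgroup_arith_ld_image scaled_subgroup_iso[OF subgroup_arith_ld_image m]
    unfolding prime_recips_def by blast
qed

end
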